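(* Let $0<\lambda\le1\le\Lambda$, let $\omega$ be as in the context, and let $\Omega\subset\mathbb H^n$ be open with finite Lebesgue measure $|\Omega|<\infty$. There exist constants $C,K$ depending only on $\lambda,\Lambda,Q,\omega,|\Omega|$ such that for every symplectic $A\in M_n(\lambda,\Lambda,\Omega)\cap C(\Omega,\omega)$ and every $u\in C^2(\Omega)$ satisfying $u\ge0$ and $\mathcal L_Au=0$ in $B_{Kr}(z_0)\subset\Omega$ (for some $z_0\in\Omega$, $r>0$), one has $$\sup_{B_r(z_0)}u\le C\inf_{B_r(z_0)}u.$$
   Context: Points $z=(x,t)\in\mathbb R^{2n+1}$; $J=\begin{pmatrix}0&-\mathbb I_n\\ \mathbb I_n&0\end{pmatrix}$, $Q=2n+2$. $\mathbb H^n$: $(x,t)\circ(\xi,\tau)=(x+\xi,t+\tau+2\langle Jx,\xi\rangle)$, $(x,t)^{-1}=(-x,-t)$; $\rho(x,t)=(|x|^4+t^2)^{1/4}$, $d(z,\zeta)=\rho(z^{-1}\circ\zeta)$, $B_R(z)=\{\zeta:d(z,\zeta)<R\}$. $X_i=\partial_{x_i}+2(Jx)_i\partial_t$, $D^2_{\mathbb H}u=(\tfrac12(X_iX_j+X_jX_i)u)_{i,j=1}^{2n}$, $\mathcal L_Au(z)=\mathrm{tr}(A(z)D^2_{\mathbb H}u(z))$. $M_n(\lambda,\Lambda,\Omega)$: symmetric matrix functions on $\Omega$ with $\det A(z)=1$ and $\lambda\mathbb I\le A(z)\le\Lambda\mathbb I$; symplectic means $A(z)^{-1}=J^tA(z)J$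 for all $z$. $\omega:[0,1)\to[0,1)$ nondecreasing with $\omega(0)=\lim_{s\to0^+}\omega(s)=0$; $C(\Omega,\omega)$: continuous $A$ with $\sup_{z\in B_\epsilon(z_0)\cap\Omega}\|A(z)-A(z_0)\|\le\omega(\epsilon)$ for all $z_0\in\Omega$, $0<\epsilon<1$. *)

theory Defs
  imports "HOL-Analysis.Analysis"
begin

text \<open>Points of H^n: z = (x,t) with x in R^{2n} indexed by 'n + 'n
  (Inl k = first block of n coordinates, Inr k = second block), t real.\<close>

type_synonym 'n hpoint = "(real ^ ('n + 'n)) \<times> real"
type_synonym 'n hmat = "real ^ ('n + 'n) ^ ('n + 'n)"

definition Jmat :: "'n::finite hmat" where
  "Jmat = (\<chi> i j. (case (i, j) of
        (Inl a, Inr b) \<Rightarrow> (if a = b then -1 else 0)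
      | (Inr a, Inl b) \<Rightarrow> (if a = b then 1 else 0)
      | _ \<Rightarrow> 0))"

definition hmult :: "'n::finite hpoint \<Rightarrow> 'n hpoint \<Rightarrow> 'n hpoint" where
  "hmult z w = (fst z + fst w, snd z + snd w + 2 * ((Jmat *v fst z) \<bullet> fst w))"

definition hinv :: "'n::finite hpoint \<Rightarrow> 'n hpoint" where
  "hinv z = (- fst z, - snd z)"

definition hgauge :: "'n::finite hpoint \<Rightarrow> real" where
  "hgauge z = (norm (fst z) ^ 4 + (snd z)\<^sup>2) powr (1/4)"

definition hdist :: "'n::finite hpoint \<Rightarrow> 'n hpoint \<Rightarrow> real" where
  "hdist z w = hgauge (hmult (hinv z) w)"

definition hball :: "'n::finite hpoint \<Rightarrow> real \<Rightarrow> 'n hpoint set" where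
  "hball z R = {w. hdist z w < R}"

definition Xfield :: "('n::finite + 'n) \<Rightarrow> 'n hpoint \<Rightarrow> 'n hpoint" where
  "Xfield i z = (axis i 1, 2 * (Jmat *v fst z) $ i)"

definition Xop :: "('n::finite + 'n) \<Rightarrow> ('n hpoint \<Rightarrow> real) \<Rightarrow> 'n hpoint \<Rightarrow> real" where
  "Xop i f z = frechet_derivative f (at z) (Xfield i z)"

definition hhess :: "('n::finite hpoint \<Rightarrow> real) \<Rightarrow> 'n hpoint \<Rightarrow> 'n hmat" where
  "hhess u z = (\<chi> i j. (Xop i (Xop j u) z + Xop j (Xop i u) z) / 2)"

definition LA :: "('n::finite hpoint \<Rightarrow> 'n hmat) \<Rightarrow> ('n hpoint \<Rightarrow> real) \<Rightarrow> 'n hpoint \<Rightarrow> real" where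
  "LA A u z = (\<Sum>i\<in>UNIV. \<Sum>j\<in>UNIV. A z $ i $ j * hhess u z $ j $ i)"

definition C2_on :: "'a::euclidean_space set \<Rightarrow> ('a \<Rightarrow> real) \<Rightarrow> bool" where
  "C2_on S u \<longleftrightarrow> (\<exists>(D1 :: 'a \<Rightarrow> 'a \<Rightarrow>\<^sub>L real) (D2 :: 'a \<Rightarrow> 'a \<Rightarrow>\<^sub>L ('a \<Rightarrow>\<^sub>L real)).
      (\<forall>z\<in>S. (u has_derivative blinfun_apply (D1 z)) (at z)) \<and>
      (\<forall>z\<in>S. (D1 has_derivative blinfun_apply (D2 z)) (at z)) \<and>
      continuous_on S D2)"

definition modulus :: "(real \<Rightarrow> real) \<Rightarrow> bool" where
  "modulus \<omega> \<longleftrightarrow> (\<forall>s\<in>{0..<1}. \<omega> s \<in> {0..<1}) \<and> mono_on {0..<1} \<omega> \<and>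
     \<omega> 0 = 0 \<and> (\<omega> \<longlongrightarrow> 0) (at_right 0)"

definition Mclass :: "real \<Rightarrow> real \<Rightarrow> 'n::finite hpoint set \<Rightarrow> ('n hpoint \<Rightarrow> 'n hmat) \<Rightarrow> bool" where
  "Mclass lam Lam \<Omega> A \<longleftrightarrow> (\<forall>z\<in>\<Omega>. transpose (A z) = A z \<and> det (A z) = 1 \<and>
     (\<forall>\<xi>. lam * (norm \<xi>)\<^sup>2 \<le> \<xi> \<bullet> (A z *v \<xi>) \<and> \<xi> \<bullet> (A z *v \<xi>) \<le> Lam * (norm \<xi>)\<^sup>2))"

definition symplectic_on :: "'n::finite hpoint set \<Rightarrow> ('n hpoint \<Rightarrow> 'n hmat) \<Rightarrow> bool" where
  "symplectic_on \<Omega> A \<longleftrightarrow> (\<forall>z\<in>\<Omega>. matrix_inv (A z) = transpose Jmat ** A z ** Jmat)"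

definition Cclass :: "'n::finite hpoint set \<Rightarrow> (real \<Rightarrow> real) \<Rightarrow> ('n hpoint \<Rightarrow> 'n hmat) \<Rightarrow> bool" where
  "Cclass \<Omega> \<omega> A \<longleftrightarrow> continuous_on \<Omega> A \<and>
     (\<forall>z0\<in>\<Omega>. \<forall>\<epsilon>. 0 < \<epsilon> \<and> \<epsilon> < 1 \<longrightarrow>
        (\<forall>z\<in>hball z0 \<epsilon> \<inter> \<Omega>. onorm (\<lambda>v. (A z - A z0) *v v) \<le> \<omega> \<epsilon>))"

end

theory Submission
  imports Defs
begin

text \<open>
  Since \<open>\<Omega>\<close> has finite measure and contains a ball of radius \<open>K r\<close>, a large \<open>K\<close> forces \<open>r\<close> to be so
  small that \<open>A\<close> is close to \<open>A\<^sub>0 = A(z\<^sub>0)\<close> on every ball that matters. As \<open>A\<^sub>0\<close> is symplectic, the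
  power \<open>\<phi>\<^bsup>-n/2\<^esup>\<close> of \<open>\<phi>(x, t) = \<langle>A\<^sub>0\<^bsup>-1\<^esup>x, x\<rangle>\<^sup>2 + t\<^sup>2\<close> is a multiple of the fundamental
  solution of the operator with constant coefficients \<open>A\<^sub>0\<close>, and the more singular power
  \<open>\<phi>\<^bsup>-(2n+1)/4\<^esup>\<close> is a subsolution off its pole for every operator with coefficients near \<open>A\<^sub>0\<close>.
  Following Landis, comparison of a nonnegative solution \<open>u\<close> with the potential of the set
  \<open>{u \<ge> t}\<close> for this kernel bounds the infimum of \<open>u\<close> from below by a multiple of \<open>t\<close> times the
  density of that set. The Harnack inequality follows by applying this bound both to \<open>u\<close> and to
  \<open>c - u\<close>.
\<close>

section \<open>The gauge and its balls\<close>

text \<open>The fundamental solution satisfies its equation with equality, so changing the matrix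
  leaves no sign to rely on. A more singular power creates a margin, and degree 1 - Q is still
  locally integrable. The margin cannot be absolute, because all terms of the computation vanish on
  the t-axis. Symplecticity, A0^-1 = J^T A0 J, gives the x-terms and the t-terms the same factor
  <A0^-1 x, x>; an error that is small relative to A0 can therefore be absorbed, and continuity of
  the coefficients suffices. Two devices keep the calculus elementary. Potentials are finite sums of
  kernels, so nothing is differentiated under an integral. A matrix A(z) is written as a sum of w
  w^T, so the operator becomes a sum of second derivatives along horizontal lines, and the maximum
  principle reduces to the one-variable test. The constant C comes out depending on the ellipticity
  bounds and the dimension only; the modulus and the measure of \<Omega> enter through K.\<close>

lemma Jmat_nth:
  "(Jmat *v x) $ Inl a = - (x $ Inr a)" "(Jmat *v x) $ Inr a = x $ Inl a"
  for x :: "real ^ ('n::finite + 'n)"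
  by (simp_all add: matrix_vector_mult_def Jmat_def UNIV_Plus_UNIV[symmetric] sum.Plus
      if_distrib[where f = "\<lambda>c. c * _"] sum_negf del: UNIV_Plus_UNIV cong: if_cong)

lemma inner_Plus:
  "x \<bullet> y = (\<Sum>a\<in>UNIV. x $ Inl a * y $ Inl a) + (\<Sum>a\<in>UNIV. x $ Inr a * y $ Inr a)"
  for x y :: "real ^ ('n::finite + 'n)"
  by (simp add: inner_vec_def UNIV_Plus_UNIV[symmetric] sum.Plus del: UNIV_Plus_UNIV)

lemma Jmat_skew: "(Jmat *v x) \<bullet> y = - (x \<bullet> (Jmat *v y))"
  for x y :: "real ^ ('n::finite + 'n)"
  by (simp add: inner_Plus Jmat_nth sum_negf)

lemma Jmat_inner_self [simp]: "(Jmat *v x) \<bullet> x = 0" "x \<bullet> (Jmat *v x) = 0"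
  for x :: "real ^ ('n::finite + 'n)"
  using Jmat_skew[of x x] by (simp_all add: inner_commute)

lemma Jmat_isometry [simp]: "(Jmat *v x) \<bullet> (Jmat *v y) = x \<bullet> y"
  for x y :: "real ^ ('n::finite + 'n)"
  by (simp add: inner_Plus Jmat_nth)

lemma norm_Jmat [simp]: "norm (Jmat *v x) = norm x"
  for x :: "real ^ ('n::finite + 'n)"
  by (simp add: norm_eq_sqrt_inner)

section \<open>The group law\<close>

lemma hmult_assoc: "hmult (hmult z w) y = hmult z (hmult w y)"
  for z w y :: "'n::finite hpoint"
  by (simp add: hmult_def matrix_vector_right_distrib inner_add_left inner_add_right algebra_simps)

lemma hmult_hinv_self [simp]: "hmult (hinv z) z = 0" "hmult z (hinv z) = 0"
  for z :: "'n::finite hpoint"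
  by (simp_all add: hmult_def hinv_def prod_eq_iff vec.neg)

lemma hmult_zero [simp]: "hmult z 0 = z" "hmult 0 z = z"
  for z :: "'n::finite hpoint"
  by (simp_all add: hmult_def prod_eq_iff)

lemma hmult_hinv_cancel: "hmult z (hmult (hinv z) w) = w" "hmult (hinv z) (hmult z w) = w"
  for z w :: "'n::finite hpoint"
  by (simp_all flip: hmult_assoc)

lemma hmult_hinv_eq:
  "hmult (hinv z) w = (fst w - fst z, snd w - snd z - 2 * ((Jmat *v fst z) \<bullet> fst w))"
  for z w :: "'n::finite hpoint"
  by (simp add: hmult_def hinv_def vec.neg)

section \<open>The homogeneous norm\<close>

lemma hgauge_cmod: "hgauge z = sqrt (cmod (Complex ((norm (fst z))\<^sup>2) (snd z)))"
  for z :: "'n::finite hpoint"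
proof -
  have "x powr (1/4) = sqrt (sqrt x)" if "0 \<le> x" for x :: real
    using that by (simp add: powr_powr flip: powr_half_sqrt)
  then show ?thesis
    by (simp add: hgauge_def complex_norm)
qed

lemma hgauge_nonneg [simp]: "0 \<le> hgauge z"
  for z :: "'n::finite hpoint"
  by (simp add: hgauge_def)

lemma hgauge_power4: "hgauge z ^ 4 = norm (fst z) ^ 4 + (snd z)\<^sup>2"
  for z :: "'n::finite hpoint"
proof -
  have "hgauge z ^ 4 = ((hgauge z)\<^sup>2)\<^sup>2"
    by simp
  also have "\<dots> = norm (fst z) ^ 4 + (snd z)\<^sup>2"
    unfolding hgauge_cmod by (simp add: complex_norm)
  finally show ?thesis .
qed

lemma hgauge_eq_0_iff [simp]: "hgauge z = 0 \<longleftrightarrow> z = 0"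
  for z :: "'n::finite hpoint"
  by (auto simp: hgauge_cmod prod_eq_iff complex_eq_iff zero_prod_def)

lemma hgauge_hinv [simp]: "hgauge (hinv z) = hgauge z"
  for z :: "'n::finite hpoint"
  by (simp add: hgauge_def hinv_def)

text \<open>With \<open>Jmat\<close> as multiplication by i, the complex number is, up to
  conjugation, the Hermitian product of x and y, so this is its Cauchy-Schwarz inequality. In real
  terms: x and Jx are orthogonal and equally long, and the real inequality is applied to p x + q Jx
  and y.\<close>

lemma cmod_inner_Jmat_le: "cmod (Complex (x \<bullet> y) ((Jmat *v x) \<bullet> y)) \<le> norm x * norm y"
  for x y :: "real ^ ('n::finite + 'n)"
proof (cases "x = 0")
  case False
  define p q where "p = x \<bullet> y" and "q = (Jmat *v x) \<bullet> y"
  define v where "v = p *\<^sub>R x + q *\<^sub>R (Jmat *v x)"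
  have vv: "v \<bullet> v = (p\<^sup>2 + q\<^sup>2) * (x \<bullet> x)"
    unfolding v_def by (simp add: inner_add_left inner_add_right power2_eq_square algebra_simps)
  have "p\<^sup>2 + q\<^sup>2 = v \<bullet> y"
    unfolding v_def by (simp add: inner_add_left p_def q_def power2_eq_square)
  then have "(p\<^sup>2 + q\<^sup>2)\<^sup>2 \<le> (v \<bullet> v) * (y \<bullet> y)"
    using Cauchy_Schwarz_ineq[of v y] by simp
  then have *: "(p\<^sup>2 + q\<^sup>2)\<^sup>2 \<le> (p\<^sup>2 + q\<^sup>2) * ((x \<bullet> x) * (y \<bullet> y))"
    unfolding vv by (simp add: mult.assoc)
  have "p\<^sup>2 + q\<^sup>2 \<le> (x \<bullet> x) * (y \<bullet> y)"
  proof (cases "p\<^sup>2 + q\<^sup>2 = 0")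
    case False
    then have "p\<^sup>2 + q\<^sup>2 > 0"
      by (metis less_eq_real_def sum_power2_ge_zero)
    then show ?thesis
      using * by (simp add: power2_eq_square[of "p\<^sup>2 + q\<^sup>2"] mult_le_cancel_left)
  qed simp
  then have "sqrt (p\<^sup>2 + q\<^sup>2) \<le> sqrt ((x \<bullet> x) * (y \<bullet> y))"
    by simp
  then show ?thesis
    unfolding complex_norm norm_eq_sqrt_inner[of x] norm_eq_sqrt_inner[of y] p_def q_def
    by (simp add: real_sqrt_mult)
qed (simp add: complex_norm)

lemma hgauge_ge_norm_fst: "norm (fst z) \<le> hgauge z"
  for z :: "'n::finite hpoint"
proof -
  have "norm (fst z) ^ 4 \<le> hgauge z ^ 4"
    by (simp add: hgauge_power4)
  then show ?thesis
    by (rule power_le_imp_le_base[where n = 3, simplified]) simp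
qed

text \<open>Writing \<open>\<rho>(x, t)\<^sup>2\<close> as the modulus of \<open>|x|\<^sup>2 + i t\<close> makes the gauge subadditive (Cygan).\<close>

lemma hgauge_hmult_le: "hgauge (hmult z w) \<le> hgauge z + hgauge w"
  for z w :: "'n::finite hpoint"
proof -
  let ?c = "\<lambda>z :: 'n hpoint. Complex ((norm (fst z))\<^sup>2) (snd z)"
  have sq: "cmod (?c v) = (hgauge v)\<^sup>2" for v :: "'n hpoint"
    by (simp add: hgauge_cmod)
  define b where "b = Complex (fst z \<bullet> fst w) ((Jmat *v fst z) \<bullet> fst w)"
  have "?c (hmult z w) = ?c z + ?c w + (b + b)"
    by (simp add: hmult_def complex_eq_iff power2_norm_eq_inner inner_add_left inner_add_right
        inner_commute b_def)
  then have "cmod (?c (hmult z w)) \<le> cmod (?c z) + cmod (?c w) + (cmod b + cmod b)"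
    using norm_triangle_ineq[of "?c z + ?c w" "b + b"] norm_triangle_ineq[of "?c z" "?c w"]
      norm_triangle_ineq[of b b] by simp
  moreover have "cmod b \<le> hgauge z * hgauge w"
    unfolding b_def
    by (rule order_trans[OF cmod_inner_Jmat_le])
       (intro mult_mono hgauge_ge_norm_fst hgauge_nonneg norm_ge_zero)
  ultimately have "(hgauge (hmult z w))\<^sup>2 \<le> (hgauge z)\<^sup>2 + (hgauge w)\<^sup>2 + 2 * (hgauge z * hgauge w)"
    unfolding sq by linarith
  then have "(hgauge (hmult z w))\<^sup>2 \<le> (hgauge z + hgauge w)\<^sup>2"
    by (simp add: power2_sum)
  then show ?thesis
    by (rule power2_le_imp_le) simp
qed

section \<open>The left-invariant distance and its topology\<close>

lemma hdist_nonneg [simp]: "0 \<le> hdist z w"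
  for z w :: "'n::finite hpoint"
  by (simp add: hdist_def)

lemma hdist_eq_0_iff [simp]: "hdist z w = 0 \<longleftrightarrow> z = w"
  for z w :: "'n::finite hpoint"
  unfolding hdist_def hgauge_eq_0_iff by (metis hmult_hinv_cancel(1) hmult_hinv_self(1) hmult_zero(1))

lemma hdist_self [simp]: "hdist z z = 0"
  for z :: "'n::finite hpoint"
  unfolding hdist_eq_0_iff ..

lemma hdist_commute: "hdist z w = hdist w z"
  for z w :: "'n::finite hpoint"
proof -
  have "hinv (hmult (hinv z) w) = hmult (hinv w) z"
    unfolding hmult_hinv_eq
    using Jmat_skew[of "fst z" "fst w"] by (simp add: hinv_def inner_commute)
  then show ?thesis
    by (metis hdist_def hgauge_hinv)
qed

lemma hdist_triangle: "hdist z y \<le> hdist z w + hdist w y"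
  for z w y :: "'n::finite hpoint"
proof -
  have "hmult (hinv z) y = hmult (hmult (hinv z) w) (hmult (hinv w) y)"
    by (simp add: hmult_assoc hmult_hinv_cancel)
  then show ?thesis
    unfolding hdist_def by (metis hgauge_hmult_le)
qed

lemma continuous_on_hmult [continuous_intros]:
  fixes f g :: "'a::topological_space \<Rightarrow> 'n::finite hpoint"
  assumes "continuous_on S f" "continuous_on S g"
  shows "continuous_on S (\<lambda>x. hmult (f x) (g x))"
  unfolding hmult_def
  by (intro continuous_intros assms matrix_vector_mult_linear_continuous_on[THEN continuous_on_compose2])
     auto

lemma continuous_on_hdist [continuous_intros]:
  fixes f g :: "'a::topological_space \<Rightarrow> 'n::finite hpoint"
  assumes "continuous_on S f" "continuous_on S g"
  shows "continuous_on S (\<lambda>x. hdist (f x) (g x))"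
  unfolding hdist_def hgauge_cmod hinv_def cmod_def
  by (auto intro!: continuous_intros assms)

lemma open_hball: "open (hball z r)"
  for z :: "'n::finite hpoint"
  unfolding hball_def by (intro open_Collect_less continuous_intros)

definition hcball :: "'n::finite hpoint \<Rightarrow> real \<Rightarrow> 'n hpoint set" where
  "hcball z R = {w. hdist z w \<le> R}"

text \<open>The gauge controls |x| by R and |t| by the square of R, so a left translate of a compact
  Euclidean box contains the ball.\<close>

lemma compact_hcball: "compact (hcball z R)"
  for z :: "'n::finite hpoint"
proof -
  have "closed (hcball z R)"
    unfolding hcball_def by (intro closed_Collect_le continuous_intros)
  moreover have "hcball z R \<subseteq> hmult z ` (cball 0 R \<times> cball 0 (R\<^sup>2))"
  proof
    fix w assume "w \<in> hcball z R"
    then have R: "hgauge (hmult (hinv z) w) \<le> R"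
      by (simp add: hcball_def hdist_def)
    define h where "h = hmult (hinv z) w"
    have "(snd h)\<^sup>2 \<le> hgauge h ^ 4"
      by (simp add: hgauge_power4)
    also have "\<dots> \<le> R ^ 4"
      using R by (intro power_mono) (auto simp: h_def)
    finally have "(snd h)\<^sup>2 \<le> (R\<^sup>2)\<^sup>2"
      by simp
    then have "\<bar>snd h\<bar> \<le> R\<^sup>2"
      using abs_le_square_iff[of "snd h" "R\<^sup>2"] by simp
    moreover have "norm (fst h) \<le> R"
      using hgauge_ge_norm_fst[of h] R by (simp add: h_def)
    ultimately have "h \<in> cball 0 R \<times> cball 0 (R\<^sup>2)"
      by (cases h) (simp add: dist_norm)
    then show "w \<in> hmult z ` (cball 0 R \<times> cball 0 (R\<^sup>2))"
      using hmult_hinv_cancel(1)[of z w] by (metis h_def image_eqI)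
  qed
  moreover have "compact (hmult z ` (cball 0 R \<times> cball 0 (R\<^sup>2)))"
    by (intro compact_continuous_image compact_Times continuous_intros) auto
  ultimately show ?thesis
    by (metis compact_Int_closed inf.absorb_iff2)
qed

section \<open>Second derivatives along lines\<close>

text \<open>A relation rather than a derivative operator: second derivatives of u and of the kernels
  can be added and scaled directly. A first derivative near 0 and its derivative at 0 are exactly
  what the second-derivative test consumes.\<close>

definition has_deriv2 :: "(real \<Rightarrow> real) \<Rightarrow> real \<Rightarrow> bool" where
  "has_deriv2 g d \<longleftrightarrow> (\<exists>g'. (\<forall>\<^sub>F s in nhds 0. (g has_real_derivative g' s) (at s)) \<and>
     (g' has_real_derivative d) (at 0))"

lemma has_deriv2_const: "has_deriv2 (\<lambda>s. c) 0"
  unfolding has_deriv2_def by (intro exI[of _ "\<lambda>s. 0"]) auto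

lemma has_deriv2_add:
  assumes "has_deriv2 f c" "has_deriv2 g d"
  shows "has_deriv2 (\<lambda>s. f s + g s) (c + d)"
proof -
  obtain f' where f: "\<forall>\<^sub>F s in nhds 0. (f has_real_derivative f' s) (at s)"
      "(f' has_real_derivative c) (at 0)"
    using assms(1) by (auto simp: has_deriv2_def)
  obtain g' where g: "\<forall>\<^sub>F s in nhds 0. (g has_real_derivative g' s) (at s)"
      "(g' has_real_derivative d) (at 0)"
    using assms(2) by (auto simp: has_deriv2_def)
  have "\<forall>\<^sub>F s in nhds 0. ((\<lambda>s. f s + g s) has_real_derivative f' s + g' s) (at s)"
    using f(1) g(1) by eventually_elim (rule DERIV_add)
  moreover have "((\<lambda>s. f' s + g' s) has_real_derivative c + d) (at 0)"
    using f(2) g(2) by (rule DERIV_add)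
  ultimately show ?thesis
    unfolding has_deriv2_def by (intro exI[of _ "\<lambda>s. f' s + g' s"] conjI)
qed

lemma has_deriv2_cmult:
  assumes "has_deriv2 f d"
  shows "has_deriv2 (\<lambda>s. c * f s) (c * d)"
proof -
  obtain f' where f: "\<forall>\<^sub>F s in nhds 0. (f has_real_derivative f' s) (at s)"
      "(f' has_real_derivative d) (at 0)"
    using assms(1) by (auto simp: has_deriv2_def)
  have "\<forall>\<^sub>F s in nhds 0. ((\<lambda>s. c * f s) has_real_derivative c * f' s) (at s)"
    using f(1) by eventually_elim (rule DERIV_cmult)
  moreover have "((\<lambda>s. c * f' s) has_real_derivative c * d) (at 0)"
    using f(2) by (rule DERIV_cmult)
  ultimately show ?thesis
    unfolding has_deriv2_def by (intro exI[of _ "\<lambda>s. c * f' s"] conjI)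
qed

lemma has_deriv2_sum:
  assumes "\<And>i. i \<in> I \<Longrightarrow> has_deriv2 (f i) (d i)"
  shows "has_deriv2 (\<lambda>s. \<Sum>i\<in>I. f i s) (\<Sum>i\<in>I. d i)"
  using assms
proof (induction I rule: infinite_finite_induct)
  case (insert i I)
  then show ?case
    by (simp add: has_deriv2_add)
qed (simp_all add: has_deriv2_const)

text \<open>At a local maximum \<open>g' 0 = 0\<close>; a positive d would make \<open>g'\<close>
  positive just to the right of 0, and the mean value theorem would give values above
  \<open>g 0\<close>.\<close>

lemma has_deriv2_local_max:
  assumes "has_deriv2 g d" and "\<forall>\<^sub>F s in nhds 0. g s \<le> g 0"
  shows "d \<le> 0"
proof (rule ccontr)
  assume "\<not> d \<le> 0"
  then have d: "0 < d" by simp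
  obtain g' where g': "\<forall>\<^sub>F s in nhds 0. (g has_real_derivative g' s) (at s)"
      and d': "(g' has_real_derivative d) (at 0)"
    using assms(1) by (auto simp: has_deriv2_def)
  obtain e where e: "0 < e" "\<And>s. \<bar>s\<bar> < e \<Longrightarrow> (g has_real_derivative g' s) (at s) \<and> g s \<le> g 0"
    using eventually_conj[OF g' assms(2)] unfolding eventually_nhds_metric dist_real_def by auto
  have "g' 0 = 0"
    using DERIV_local_max[of g "g' 0" 0 e] e by auto
  then obtain e' where e': "0 < e'" "\<And>h. 0 < h \<Longrightarrow> h < e' \<Longrightarrow> 0 < g' h"
    using DERIV_pos_inc_right[OF d' d] by auto
  define h where "h = min e e' / 2"
  have h: "0 < h" "h < e" "h < e'"
    using e e' by (auto simp: h_def)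
  have "\<exists>z. 0 < z \<and> z < h \<and> g h - g 0 = (h - 0) * g' z"
    using h e by (intro MVT2) auto
  then obtain z where z: "0 < z" "z < h" "g h - g 0 = h * g' z"
    by auto
  then have "0 < g h - g 0"
    using h e'(2)[of z] by simp
  then show False
    using e(2)[of h] h by simp
qed

lemma has_deriv2_powr:
  assumes F: "\<And>s. (F has_real_derivative F' s) (at s)"
    and F': "(F' has_real_derivative d) (at 0)" and pos: "0 < F 0"
  shows "has_deriv2 (\<lambda>s. F s powr (- a)) (a * F 0 powr (- a - 2) * ((a + 1) * (F' 0)\<^sup>2 - F 0 * d))"
proof -
  have "isCont F 0"
    using F DERIV_isCont by blast
  then have "\<forall>\<^sub>F s in nhds 0. 0 < F s"
    using pos by (metis isCont_def order_tendstoD(1) tendsto_at_iff_tendsto_nhds)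
  then have "\<forall>\<^sub>F s in nhds 0. ((\<lambda>s. F s powr (- a)) has_real_derivative
      - a * (F s powr (- a - 1) * F' s)) (at s)"
  proof eventually_elim
    case (elim s)
    then show ?case
      by (auto intro!: derivative_eq_intros F)
  qed
  moreover have "((\<lambda>s. - a * (F s powr (- a - 1) * F' s)) has_real_derivative
      a * F 0 powr (- a - 2) * ((a + 1) * (F' 0)\<^sup>2 - F 0 * d)) (at 0)"
  proof -
    have "F 0 powr (1 + (- a - 2)) = F 0 * F 0 powr (- a - 2)"
      using pos by (simp only: powr_add powr_one)
    moreover have "1 + (- a - 2) = - a - 1"
      by simp
    ultimately have "F 0 powr (- a - 1) = F 0 * F 0 powr (- a - 2)"
      by (simp only:)
    then show ?thesis
      using pos by (auto intro!: derivative_eq_intros F F' simp: power2_eq_square algebra_simps)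
  qed
  ultimately show ?thesis
    unfolding has_deriv2_def by (intro exI[of _ "\<lambda>s. - a * (F s powr (- a - 1) * F' s)"] conjI)
qed

section \<open>Rank-one decompositions of positive semidefinite matrices\<close>

text \<open>B is the sum of the matrices w w^T, which turns the trace of B times a Hessian into a
  sum of second derivatives in the directions \<open>w k\<close>. Using the coordinate type itself
  as index set leaves room for zero vectors.\<close>

definition rank_one_decomp :: "real ^ 'm ^ 'm \<Rightarrow> ('m::finite \<Rightarrow> real ^ 'm) \<Rightarrow> bool" where
  "rank_one_decomp B w \<longleftrightarrow> (\<forall>i j. B $ i $ j = (\<Sum>k\<in>UNIV. w k $ i * w k $ j))"

lemma inner_symmetric_matrix:
  fixes B :: "real ^ 'm::finite ^ 'm"
  assumes "transpose B = B"
  shows "(B *v x) \<bullet> y = x \<bullet> (B *v y)"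
  by (metis assms dot_lmul_matrix inner_commute matrix_transpose_mul transpose_matrix_vector)

text \<open>Cholesky elimination, by induction on a set containing all nonzero rows. If the pivot b
  is positive, subtracting v v^T, with v the pivot column divided by the root of b, clears row
  \<open>i0\<close> and leaves the Schur complement, again positive semidefinite. If b = 0,
  positivity forces the whole row to vanish.\<close>

lemma psd_rank_one_decomp_aux:
  fixes B :: "real ^ 'm::finite ^ 'm"
  assumes "finite I" "transpose B = B" "\<And>x. 0 \<le> x \<bullet> (B *v x)"
    and "\<And>i j. i \<notin> I \<Longrightarrow> B $ i $ j = 0"
  shows "\<exists>w. \<forall>i j. B $ i $ j = (\<Sum>k\<in>I. w k $ i * w k $ j)"
  using assms
proof (induction I arbitrary: B rule: finite_induct)
  case empty
  then show ?case by simp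
next
  case (insert i0 I)
  have sym: "B $ i $ j = B $ j $ i" for i j
    using arg_cong[OF insert.prems(1), of "\<lambda>M. M $ i $ j"] by (simp add: transpose_def)
  have ax: "axis i 1 \<bullet> (B *v y) = (B *v axis i 1) \<bullet> y" "(B *v axis i 1) $ j = B $ j $ i" for i j y
    by (simp_all only: inner_symmetric_matrix[OF insert.prems(1)])
       (simp add: matrix_vector_mult_basis column_def)
  define b where "b = B $ i0 $ i0"
  have axax: "axis i 1 \<bullet> (B *v axis j 1) = B $ i $ j" for i j
    by (simp add: inner_axis' ax)
  have b0: "0 \<le> b"
    using insert.prems(2)[of "axis i0 1"] by (simp add: axax b_def)
  show ?case
  proof (cases "b = 0")
    case True
    have row0: "B $ i0 $ j = 0" for j
    proof (rule ccontr)
      assume nz: "B $ i0 $ j \<noteq> 0"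
      \<comment> \<open>With zero pivot the form is affine in s at e_j + s e_i0; this s gives it the
        value -1.\<close>
      define s where "s = - (B $ j $ j + 1) / (2 * B $ i0 $ j)"
      have "0 \<le> (axis j 1 + s *\<^sub>R axis i0 1) \<bullet> (B *v (axis j 1 + s *\<^sub>R axis i0 1))"
        by (rule insert.prems(2))
      also have "\<dots> = B $ j $ j + 2 * s * B $ i0 $ j"
        using True sym[of j i0]
        by (simp add: matrix_vector_right_distrib matrix_vector_mult_scaleR
            inner_add_left inner_add_right axax b_def)
      also have "\<dots> = - 1"
        using nz by (simp add: s_def field_simps)
      finally show False by simp
    qed
    then have "\<exists>w. \<forall>i j. B $ i $ j = (\<Sum>k\<in>I. w k $ i * w k $ j)"
      using insert.prems row0 by (intro insert.IH) (metis insert_iff)+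
    then obtain w where w: "\<And>i j. B $ i $ j = (\<Sum>k\<in>I. w k $ i * w k $ j)"
      by blast
    show ?thesis
      using insert.hyps
      by (intro exI[of _ "w(i0 := 0)"]) (simp add: w cong: sum.cong, auto intro!: sum.cong)
  next
    case False
    with b0 have b: "0 < b" by simp
    define v where "v = (1 / sqrt b) *\<^sub>R (B *v axis i0 1)"
    define B' where "B' = (\<chi> i j. B $ i $ j - v $ i * v $ j)"
    have B'v: "B' *v x = B *v x - (v \<bullet> x) *\<^sub>R v" for x
      by (simp add: vec_eq_iff B'_def matrix_vector_mult_def inner_vec_def sum_subtractf
          sum_distrib_left sum_distrib_right algebra_simps)
    have "0 \<le> x \<bullet> (B' *v x)" for x
    proof -
      \<comment> \<open>The minimiser of the form of B over x - c e_i0; the minimum is the form of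
        the Schur complement at x.\<close>
      define c where "c = (v \<bullet> x) / sqrt b"
      have "(B *v axis i0 1) \<bullet> x = sqrt b * (v \<bullet> x)"
        using b by (simp add: v_def)
      then have Be: "x \<bullet> (B *v axis i0 1) = sqrt b * (v \<bullet> x)"
          "axis i0 1 \<bullet> (B *v x) = sqrt b * (v \<bullet> x)"
        by (simp_all only: inner_commute[of x] ax(1))
      have axb: "axis i0 1 \<bullet> (B *v axis i0 1) = b"
        by (simp only: axax b_def)
      have "0 \<le> (x - c *\<^sub>R axis i0 1) \<bullet> (B *v (x - c *\<^sub>R axis i0 1))"
        by (rule insert.prems(2))
      also have "\<dots> = x \<bullet> (B *v x) - 2 * c * (sqrt b * (v \<bullet> x)) + c * c * b"
        by (simp add: matrix_vector_mult_diff_distrib matrix_vector_mult_scaleR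
            inner_diff_left inner_diff_right Be axb algebra_simps)
      also have "\<dots> = x \<bullet> (B *v x) - (v \<bullet> x)\<^sup>2"
        using b by (simp add: c_def power2_eq_square)
      finally show ?thesis
        by (simp add: B'v inner_diff_right power2_eq_square inner_commute)
    qed
    moreover have "transpose B' = B'"
      by (simp add: B'_def transpose_def vec_eq_iff sym mult.commute)
    moreover have "B' $ i $ j = 0" if "i \<notin> I" for i j
    proof (cases "i = i0")
      case True
      have "v $ i0 * v $ j = B $ i0 $ j"
        using b sym[of j i0] by (simp add: v_def ax b_def real_sqrt_mult_self)
      with True show ?thesis by (simp add: B'_def)
    next
      case False
      with that insert.prems(3) have "B $ i $ j = 0" "B $ i $ i0 = 0" for j
        by auto
      then show ?thesis by (simp add: B'_def v_def ax)
    qed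
    ultimately obtain w where w: "\<And>i j. B' $ i $ j = (\<Sum>k\<in>I. w k $ i * w k $ j)"
      using insert.IH[of B'] by blast
    have "B $ i $ j = v $ i * v $ j + (\<Sum>k\<in>I. w k $ i * w k $ j)" for i j
      unfolding w[symmetric] by (simp add: B'_def)
    moreover have "(\<Sum>k\<in>I. w k $ i * w k $ j) = (\<Sum>k\<in>I. (w(i0 := v)) k $ i * (w(i0 := v)) k $ j)" for i j
      using insert.hyps by (intro sum.cong) auto
    ultimately show ?thesis
      using insert.hyps by (intro exI[of _ "w(i0 := v)"]) simp
  qed
qed

lemma psd_rank_one_decomp:
  fixes B :: "real ^ 'm::finite ^ 'm"
  assumes "transpose B = B" "\<And>x. 0 \<le> x \<bullet> (B *v x)"
  obtains w where "rank_one_decomp B w"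
  using psd_rank_one_decomp_aux[of UNIV B] assms by (auto simp: rank_one_decomp_def)

lemma rank_one_decomp_quadratic:
  assumes "rank_one_decomp B w"
  shows "x \<bullet> (B *v x) = (\<Sum>k\<in>UNIV. (w k \<bullet> x)\<^sup>2)"
proof -
  have "x \<bullet> (B *v x) = (\<Sum>i\<in>UNIV. \<Sum>j\<in>UNIV. \<Sum>k\<in>UNIV. x $ i * w k $ i * (x $ j * w k $ j))"
    using assms
    by (simp add: inner_vec_def matrix_vector_mult_def rank_one_decomp_def sum_distrib_left
        sum_distrib_right mult_ac)
  also have "\<dots> = (\<Sum>k\<in>UNIV. \<Sum>i\<in>UNIV. \<Sum>j\<in>UNIV. x $ i * w k $ i * (x $ j * w k $ j))"
    by (rule trans[OF sum.cong[OF refl sum.swap] sum.swap])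
  also have "\<dots> = (\<Sum>k\<in>UNIV. (w k \<bullet> x)\<^sup>2)"
    by (simp add: inner_vec_def power2_eq_square sum_product mult_ac)
  finally show ?thesis .
qed

lemma rank_one_decomp_trace:
  assumes "rank_one_decomp B w"
  shows "(\<Sum>i\<in>UNIV. \<Sum>j\<in>UNIV. B $ i $ j * M $ i $ j) = (\<Sum>k\<in>UNIV. w k \<bullet> (M *v w k))"
proof -
  have "(\<Sum>i\<in>UNIV. \<Sum>j\<in>UNIV. B $ i $ j * M $ i $ j)
      = (\<Sum>i\<in>UNIV. \<Sum>j\<in>UNIV. \<Sum>k\<in>UNIV. w k $ i * (M $ i $ j * w k $ j))"
    using assms by (simp add: rank_one_decomp_def sum_distrib_left sum_distrib_right mult_ac)
  also have "\<dots> = (\<Sum>i\<in>UNIV. \<Sum>k\<in>UNIV. \<Sum>j\<in>UNIV. w k $ i * (M $ i $ j * w k $ j))"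
    by (intro sum.cong refl sum.swap)
  also have "\<dots> = (\<Sum>k\<in>UNIV. \<Sum>i\<in>UNIV. \<Sum>j\<in>UNIV. w k $ i * (M $ i $ j * w k $ j))"
    by (rule sum.swap)
  also have "\<dots> = (\<Sum>k\<in>UNIV. w k \<bullet> (M *v w k))"
    by (simp add: inner_vec_def matrix_vector_mult_def sum_distrib_left)
  finally show ?thesis .
qed

section \<open>The comparison kernel\<close>

definition phi :: "'n hmat \<Rightarrow> 'n::finite hpoint \<Rightarrow> real" where
  "phi P h = (fst h \<bullet> (P *v fst h))\<^sup>2 + (snd h)\<^sup>2"

text \<open>The exponent \<open>-(2n+1)/4\<close> makes this a function of homogeneous degree \<open>1 - Q\<close>, strictly
  between the degree \<open>2 - Q\<close> of the fundamental solution and the degree \<open>- Q\<close> at which local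
  integrability is lost.\<close>

definition kern :: "'n hmat \<Rightarrow> 'n::finite hpoint \<Rightarrow> real" where
  "kern P h = phi P h powr (- ((2 * real CARD('n) + 1) / 4))"

text \<open>P stands for the inverse of A0. Symplecticity enters as \<open>P_J\<close>: the
  A0-length of Jx equals the P-length of x.\<close>

locale frozen_coeffs =
  fixes A0 P :: "'n::finite hmat"
  assumes P_sym: "transpose P = P" and A0_P: "\<And>x. A0 *v (P *v x) = x"
    and A0_sym: "transpose A0 = A0"
    and P_psd: "\<And>x. 0 \<le> x \<bullet> (P *v x)"
    and P_J: "\<And>x. (Jmat *v x) \<bullet> (A0 *v (Jmat *v x)) = x \<bullet> (P *v x)"
begin

text \<open>The tolerance e = 1/(4n+9) solves (8n+20)(1-e) = (8n+16)(1+e). The left coefficient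
  belongs to the first-order terms for the chosen exponent, the right one to the second-order terms;
  for the exponent of the fundamental solution both would be 8n+16, leaving no tolerance.\<close>

definition near_A0 :: "'n hmat \<Rightarrow> bool" where
  "near_A0 A \<longleftrightarrow> (\<forall>y. (1 - 1 / (4 * real CARD('n) + 9)) * (y \<bullet> (A0 *v y)) \<le> y \<bullet> (A *v y)
      \<and> y \<bullet> (A *v y) \<le> (1 + 1 / (4 * real CARD('n) + 9)) * (y \<bullet> (A0 *v y)))"

lemma trace_A0_P: "(\<Sum>i\<in>UNIV. \<Sum>j\<in>UNIV. P $ i $ j * A0 $ i $ j) = 2 * real CARD('n)"
proof -
  have "A0 ** P = mat 1"
    by (simp add: matrix_eq A0_P flip: matrix_vector_mul_assoc)
  then have "(A0 ** P) $ i $ i = 1" for i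
    by (simp add: mat_def)
  then have 1: "(\<Sum>j\<in>UNIV. A0 $ i $ j * P $ j $ i) = 1" for i
    by (simp add: matrix_matrix_mult_def)
  have sym: "P $ i $ j = P $ j $ i" for i j
    using arg_cong[OF P_sym, of "\<lambda>M. M $ i $ j"] by (simp add: transpose_def)
  have "(\<Sum>j\<in>UNIV. P $ i $ j * A0 $ i $ j) = (\<Sum>j\<in>UNIV. A0 $ i $ j * P $ j $ i)" for i
    by (intro sum.cong) (auto simp: mult.commute intro: sym)
  then have "(\<Sum>j\<in>UNIV. P $ i $ j * A0 $ i $ j) = 1" for i
    using 1 by simp
  then show ?thesis by simp
qed

text \<open>Along each horizontal line \<open>phi\<close> is a polynomial F, and F^-a has second
  derivative a F^(-a-2) ((a+1) F'^2 - F F''). After summation over the directions, the first part is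
  at least, and the second at most, a constant times N * ph, and the choice of tolerance makes these
  two constants equal.\<close>

lemma kern_subsolution:
  fixes A :: "'n hmat"
  assumes near: "near_A0 A" and w: "rank_one_decomp A w" and pos: "0 < phi P h"
  obtains d where "\<And>k. has_deriv2 (\<lambda>s. kern P (hmult h (s *\<^sub>R w k, 0))) (d k)"
    and "0 \<le> (\<Sum>k\<in>UNIV. d k)"
proof
  define e where "e = 1 / (4 * real CARD('n) + 9)"
  define x t where "x = fst h" and "t = snd h"
  have h: "h = (x, t)"
    by (simp add: x_def t_def)
  define N where "N = x \<bullet> (P *v x)"
  define ph where "ph = N\<^sup>2 + t\<^sup>2"
  define a where "a = (2 * real CARD('n) + 1) / 4"
  define p where "p k = w k \<bullet> (P *v x)" for k
  define q where "q k = w k \<bullet> (P *v w k)" for k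
  define j where "j k = w k \<bullet> (Jmat *v x)" for k
  define F where "F k s = (N + 2 * s * p k + s\<^sup>2 * q k)\<^sup>2 + (t + 2 * s * j k)\<^sup>2" for k s
  define F' where "F' k s = 2 * (N + 2 * s * p k + s\<^sup>2 * q k) * (2 * p k + 2 * s * q k)
      + 2 * (t + 2 * s * j k) * (2 * j k)" for k s
  define d where "d k = a * F k 0 powr (- a - 2) * ((a + 1) * (F' k 0)\<^sup>2
      - F k 0 * (8 * (p k)\<^sup>2 + 4 * N * q k + 8 * (j k)\<^sup>2))" for k
  have N0: "0 \<le> N"
    by (simp add: N_def P_psd)
  have ph: "ph = phi P h" "F k 0 = ph" for k
    by (simp_all add: ph_def phi_def h N_def F_def)
  have a0: "0 \<le> a" by (simp add: a_def)
  have F_eq: "phi P (hmult h (s *\<^sub>R w k, 0)) = F k s" for k s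
    using inner_symmetric_matrix[OF P_sym, of x "w k"]
    by (simp add: phi_def hmult_def h F_def N_def p_def q_def j_def matrix_vector_right_distrib
        matrix_vector_mult_scaleR inner_add_left inner_add_right inner_commute power2_eq_square
        algebra_simps)
  show "has_deriv2 (\<lambda>s. kern P (hmult h (s *\<^sub>R w k, 0))) (d k)" for k
    unfolding kern_def F_eq d_def a_def[symmetric]
  proof (rule has_deriv2_powr)
    show "(F k has_real_derivative F' k s) (at s)" for s
      unfolding F_def F'_def by (auto intro!: derivative_eq_intros simp: algebra_simps)
    show "(F' k has_real_derivative 8 * (p k)\<^sup>2 + 4 * N * q k + 8 * (j k)\<^sup>2) (at 0)"
      unfolding F'_def by (auto intro!: derivative_eq_intros simp: algebra_simps power2_eq_square)
    show "0 < F k 0"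
      using pos by (simp add: ph)
  qed
  \<comment> \<open>\<open>4 * v\<close> is the horizontal gradient of \<open>phi\<close>. Its
    A0-length is exactly N * ph: the mixed term is a multiple of <x, Jx> = 0, and both pure terms
    carry the factor N, the second one by \<open>P_J\<close>.\<close>
  define v where "v = N *\<^sub>R (P *v x) + t *\<^sub>R (Jmat *v x)"
  have lo: "(1 - e) * (y \<bullet> (A0 *v y)) \<le> y \<bullet> (A *v y)"
    and up: "y \<bullet> (A *v y) \<le> (1 + e) * (y \<bullet> (A0 *v y))" for y
    using near by (simp_all add: near_A0_def e_def)
  have quad: "(\<Sum>k\<in>UNIV. (w k \<bullet> y)\<^sup>2) = y \<bullet> (A *v y)" for y
    by (simp add: rank_one_decomp_quadratic[OF w])
  have PxPx: "(P *v x) \<bullet> (A0 *v (P *v x)) = N"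
    by (simp add: A0_P N_def inner_commute)
  have "v \<bullet> (A0 *v v) = N * ph"
  proof -
    have "(P *v x) \<bullet> (A0 *v (Jmat *v x)) = 0"
      using inner_symmetric_matrix[OF A0_sym, of "P *v x" "Jmat *v x"] by (simp add: A0_P)
    then show ?thesis
      unfolding v_def
      by (simp add: matrix_vector_right_distrib matrix_vector_mult_scaleR A0_P inner_add_left
          inner_add_right P_J ph_def power2_eq_square algebra_simps flip: N_def)
         (simp add: N_def inner_commute)
  qed
  then have sv: "(1 - e) * (N * ph) \<le> (\<Sum>k\<in>UNIV. (w k \<bullet> v)\<^sup>2)"
    using lo[of v] by (simp add: quad)
  have sp: "(\<Sum>k\<in>UNIV. (p k)\<^sup>2) \<le> (1 + e) * N"
    using up[of "P *v x"] by (simp add: p_def quad PxPx)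
  have sj: "(\<Sum>k\<in>UNIV. (j k)\<^sup>2) \<le> (1 + e) * N"
    using up[of "Jmat *v x"] by (simp add: j_def quad P_J N_def)
  have sq: "(\<Sum>k\<in>UNIV. q k) \<le> (1 + e) * (2 * real CARD('n))"
  proof -
    \<comment> \<open>The trace of P A is expanded along a decomposition of P instead of A, so that
      the upper bound for A against A0 applies vector by vector and leaves the trace of P A0, which
      is 2n.\<close>
    obtain p' where p': "rank_one_decomp P p'"
      using psd_rank_one_decomp[OF P_sym P_psd] .
    have "(\<Sum>k\<in>UNIV. q k) = (\<Sum>i\<in>UNIV. \<Sum>j\<in>UNIV. P $ i $ j * A $ i $ j)"
      unfolding q_def rank_one_decomp_trace[OF w, symmetric] by (simp add: mult.commute)
    also have "\<dots> = (\<Sum>l\<in>UNIV. p' l \<bullet> (A *v p' l))"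
      by (rule rank_one_decomp_trace[OF p'])
    also have "\<dots> \<le> (\<Sum>l\<in>UNIV. (1 + e) * (p' l \<bullet> (A0 *v p' l)))"
      by (intro sum_mono up)
    also have "\<dots> = (1 + e) * (2 * real CARD('n))"
      unfolding sum_distrib_left[symmetric] rank_one_decomp_trace[OF p', symmetric] trace_A0_P ..
    finally show ?thesis .
  qed
  have F'0: "F' k 0 = 4 * (w k \<bullet> v)" for k
    by (simp add: F'_def v_def p_def j_def inner_add_right algebra_simps)
  define S where "S = (a + 1) * (\<Sum>k\<in>UNIV. (F' k 0)\<^sup>2)
      - ph * (8 * (\<Sum>k\<in>UNIV. (p k)\<^sup>2) + 4 * N * (\<Sum>k\<in>UNIV. q k) + 8 * (\<Sum>k\<in>UNIV. (j k)\<^sup>2))"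
  have sum_d: "(\<Sum>k\<in>UNIV. d k) = a * ph powr (- a - 2) * S"
    unfolding d_def ph S_def
    by (simp add: sum_distrib_left sum_distrib_right sum_subtractf sum.distrib algebra_simps)
  have "0 \<le> S"
  proof -
    have "8 * (\<Sum>k\<in>UNIV. (p k)\<^sup>2) + 4 * N * (\<Sum>k\<in>UNIV. q k) + 8 * (\<Sum>k\<in>UNIV. (j k)\<^sup>2)
        \<le> 8 * ((1 + e) * N) + 4 * N * ((1 + e) * (2 * real CARD('n))) + 8 * ((1 + e) * N)"
      using N0 by (intro add_mono mult_left_mono sp sj sq) auto
    then have "ph * (8 * (\<Sum>k\<in>UNIV. (p k)\<^sup>2) + 4 * N * (\<Sum>k\<in>UNIV. q k) + 8 * (\<Sum>k\<in>UNIV. (j k)\<^sup>2))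
        \<le> ph * (8 * ((1 + e) * N) + 4 * N * ((1 + e) * (2 * real CARD('n))) + 8 * ((1 + e) * N))"
      using pos by (intro mult_left_mono) (auto simp: ph)
    moreover have "(a + 1) * (16 * ((1 - e) * (N * ph))) \<le> (a + 1) * (\<Sum>k\<in>UNIV. (F' k 0)\<^sup>2)"
      using sv a0 by (intro mult_left_mono) (auto simp: F'0 power_mult_distrib simp flip: sum_distrib_left)
    moreover have "(a + 1) * (16 * ((1 - e) * (N * ph)))
      = ph * (8 * ((1 + e) * N) + 4 * N * ((1 + e) * (2 * real CARD('n))) + 8 * ((1 + e) * N))"
    proof -
      have "e * (4 * real CARD('n) + 9) = 1"
        by (simp add: e_def add_nonneg_eq_0_iff)
      then have "4 * (2 * real CARD('n) + 5) * (1 - e) = (16 + 8 * real CARD('n)) * (1 + e)"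
        by (simp add: algebra_simps)
      moreover have "(a + 1) * 16 = 4 * (2 * real CARD('n) + 5)"
        by (simp add: a_def)
      ultimately have "(a + 1) * 16 * (1 - e) = (16 + 8 * real CARD('n)) * (1 + e)"
        by (simp only:)
      then have "(a + 1) * 16 * (1 - e) * (N * ph) = (16 + 8 * real CARD('n)) * (1 + e) * (N * ph)"
        by simp
      then show ?thesis
        by (simp add: algebra_simps)
    qed
    ultimately show ?thesis
      unfolding S_def by linarith
  qed
  then show "0 \<le> (\<Sum>k\<in>UNIV. d k)"
    unfolding sum_d using a0 by simp
qed

end

section \<open>Measure of balls\<close>

text \<open>Left translation shifts t by an amount depending on x, so gauge balls are compared with
  sheared cylinders. By Fubini the shear is harmless: every slice is an interval of length
  2b.\<close>

lemma emeasure_shear_cylinder: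
  fixes c :: "'a::euclidean_space" and f :: "'a \<Rightarrow> real"
  assumes f: "continuous_on UNIV f" and "0 \<le> a" "0 \<le> b"
  shows "emeasure lborel {(x, t). x \<in> ball c a \<and> \<bar>t - f x\<bar> < b}
    = ennreal (unit_ball_vol (real DIM('a)) * a ^ DIM('a) * (2 * b))"
proof -
  let ?T = "{(x, t). x \<in> ball c a \<and> \<bar>t - f x\<bar> < b}"
  have "?T = {p. dist c (fst p) < a} \<inter> {p. \<bar>snd p - f (fst p)\<bar> < b}"
    by auto
  moreover have "open \<dots>"
    by (intro open_Int open_Collect_less continuous_intros continuous_on_compose2[OF f]) auto
  ultimately have meas: "?T \<in> sets (lborel \<Otimes>\<^sub>M lborel)"
    unfolding lborel_prod by simp
  have slice: "emeasure lborel (Pair x -` ?T) = ennreal (2 * b) * indicator (ball c a) x" for x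
  proof (cases "x \<in> ball c a")
    case True
    then have "Pair x -` ?T = {f x - b<..<f x + b}"
      by (auto simp: abs_less_iff)
    with True assms(3) show ?thesis by simp
  next
    case False
    then have "Pair x -` ?T = {}"
      by auto
    with False show ?thesis
      by (simp del: mem_ball)
  qed
  have "emeasure lborel ?T = emeasure (lborel \<Otimes>\<^sub>M lborel) ?T"
    by (simp add: lborel_prod)
  also have "\<dots> = (\<integral>\<^sup>+ x. ennreal (2 * b) * indicator (ball c a) x \<partial>lborel)"
    by (subst lborel.emeasure_pair_measure_alt[OF meas]) (simp only: slice)
  also have "\<dots> = ennreal (2 * b) * emeasure lborel (ball c a)"
    by (rule nn_integral_cmult_indicator) simp
  also have "\<dots> = ennreal (unit_ball_vol (real DIM('a)) * a ^ DIM('a) * (2 * b))"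
    using assms by (simp add: emeasure_ball ac_simps flip: ennreal_mult)
  finally show ?thesis .
qed

lemma borel_hball [measurable]: "hball z r \<in> sets borel"
  for z :: "'n::finite hpoint"
  by (simp add: open_hball)

text \<open>A ball contains the cylinder of sizes r/2 and r^2/2, because 1/16 + 1/4 < 1, and lies in
  the one of sizes r and r^2. The exponent Q is 2n from the x-variables plus 2 from t.\<close>

lemma emeasure_hball_bounds:
  obtains c C :: real where "0 < c" "0 < C"
    "\<And>(z :: 'n::finite hpoint) r. 0 < r \<Longrightarrow> ennreal (c * r ^ (2 * CARD('n) + 2)) \<le> emeasure lborel (hball z r)"
    "\<And>(z :: 'n hpoint) r. 0 < r \<Longrightarrow> emeasure lborel (hball z r) \<le> ennreal (C * r ^ (2 * CARD('n) + 2))"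
proof
  define V where "V = unit_ball_vol (real (2 * CARD('n)))"
  have V: "0 < V" by (simp add: V_def)
  show "0 < V / 2 ^ (2 * CARD('n))" "0 < 2 * V"
    using V by auto
  define cyl where "cyl z a b = {(x, t). x \<in> ball (fst z) a \<and>
    \<bar>t - (snd z + 2 * ((Jmat *v fst z) \<bullet> x))\<bar> < b}" for z :: "'n hpoint" and a b
  have cyl: "emeasure lborel (cyl z a b) = ennreal (V * a ^ (2 * CARD('n)) * (2 * b))"
    if "0 \<le> a" "0 \<le> b" for z a b
  proof -
    have "DIM(real ^ ('n + 'n)) = 2 * CARD('n)"
      by simp
    moreover have "continuous_on UNIV (\<lambda>x. snd z + 2 * ((Jmat *v fst z) \<bullet> x))"
      by (intro continuous_intros)
    ultimately show ?thesis
      unfolding cyl_def V_def using that by (simp only: emeasure_shear_cylinder)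
  qed
  have d4: "hdist z w ^ 4 = norm (fst w - fst z) ^ 4
      + (snd w - (snd z + 2 * ((Jmat *v fst z) \<bullet> fst w)))\<^sup>2" for z w :: "'n hpoint"
    by (simp add: hdist_def hgauge_power4 hmult_hinv_eq algebra_simps)
  fix z :: "'n hpoint" and r :: real
  assume r: "0 < r"
  have "cyl z (r / 2) (r\<^sup>2 / 2) \<subseteq> hball z r"
  proof
    fix w assume w: "w \<in> cyl z (r / 2) (r\<^sup>2 / 2)"
    then have "norm (fst w - fst z) ^ 4 \<le> (r / 2) ^ 4"
      by (intro power_mono) (auto simp: cyl_def dist_norm norm_minus_commute)
    moreover have "(snd w - (snd z + 2 * ((Jmat *v fst z) \<bullet> fst w)))\<^sup>2 \<le> (r\<^sup>2 / 2)\<^sup>2"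
      using w by (intro power2_le_iff_abs_le[THEN iffD2]) (auto simp: cyl_def)
    ultimately have "hdist z w ^ 4 \<le> (r / 2) ^ 4 + (r\<^sup>2 / 2)\<^sup>2"
      unfolding d4 by (rule add_mono)
    also have "\<dots> = (5 / 16) * r ^ 4"
      by (simp add: power_divide)
    also have "\<dots> < r ^ 4"
      using r by simp
    finally show "w \<in> hball z r"
      using r power_less_imp_less_base[of "hdist z w" 4 r] by (simp add: hball_def)
  qed
  then have "emeasure lborel (cyl z (r / 2) (r\<^sup>2 / 2)) \<le> emeasure lborel (hball z r)"
    by (intro emeasure_mono) auto
  then show "ennreal (V / 2 ^ (2 * CARD('n)) * r ^ (2 * CARD('n) + 2)) \<le> emeasure lborel (hball z r)"
    using r by (simp add: cyl power_divide power_add power2_eq_square mult_ac)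
  have "hball z r \<subseteq> cyl z r (r\<^sup>2)"
  proof
    fix w assume "w \<in> hball z r"
    then have "hdist z w ^ 4 < r ^ 4"
      by (intro power_strict_mono) (auto simp: hball_def)
    then have *: "norm (fst w - fst z) ^ 4 < r ^ 4"
        "(snd w - (snd z + 2 * ((Jmat *v fst z) \<bullet> fst w)))\<^sup>2 < (r\<^sup>2)\<^sup>2"
      unfolding d4 by (auto intro: le_less_trans[rotated])
    have "norm (fst w - fst z) < r"
      using *(1) r by (intro power_less_imp_less_base[OF *(1)]) auto
    moreover have "\<bar>snd w - (snd z + 2 * ((Jmat *v fst z) \<bullet> fst w))\<bar> < r\<^sup>2"
      using *(2) power2_less_imp_less[of "\<bar>snd w - (snd z + 2 * ((Jmat *v fst z) \<bullet> fst w))\<bar>" "r\<^sup>2"]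
      by simp
    ultimately show "w \<in> cyl z r (r\<^sup>2)"
      by (cases w) (auto simp: cyl_def dist_norm norm_minus_commute)
  qed
  then have "emeasure lborel (hball z r) \<le> emeasure lborel (cyl z r (r\<^sup>2))"
  proof (rule emeasure_mono)
    have "cyl z r (r\<^sup>2) = {p. dist (fst z) (fst p) < r} \<inter>
        {p. \<bar>snd p - (snd z + 2 * ((Jmat *v fst z) \<bullet> fst p))\<bar> < r\<^sup>2}"
      by (auto simp: cyl_def)
    moreover have "open \<dots>"
      by (intro open_Int open_Collect_less continuous_intros)
    ultimately show "cyl z r (r\<^sup>2) \<in> sets lborel"
      by simp
  qed
  then show "emeasure lborel (hball z r) \<le> ennreal (2 * V * r ^ (2 * CARD('n) + 2))"
    using r by (simp add: cyl power_add power2_eq_square mult_ac)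
qed

text \<open>The kernel has degree 1 - Q while balls have volume of order r^Q. On the k-th dyadic
  shell the integrand is at most (2^(k+1)/r)^(Q-1), so the contributions are dominated by a
  geometric series of ratio 1/2.\<close>

lemma nn_integral_hdist_pole:
  obtains C :: real where "0 < C"
    "\<And>(z :: 'n::finite hpoint) r. 0 < r \<Longrightarrow>
      (\<integral>\<^sup>+ w. ennreal (1 / hdist z w ^ (2 * CARD('n) + 1)) * indicator (hball z r) w \<partial>lborel)
        \<le> ennreal (C * r)"
proof -
  define m where "m = 2 * CARD('n) + 1"
  obtain C1 :: real where C1: "0 < C1"
      "\<And>(z :: 'n hpoint) r. 0 < r \<Longrightarrow> emeasure lborel (hball z r) \<le> ennreal (C1 * r ^ Suc m)"
    using emeasure_hball_bounds[where 'n = 'n] unfolding m_def by (metis add_Suc_right numeral_2_eq_2 One_nat_def)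
  show thesis
  proof
    show "0 < 2 ^ Suc m * C1"
      using C1 by simp
    fix z :: "'n hpoint" and r :: real
    assume r: "0 < r"
    define f where "f k w = ennreal ((2 ^ Suc k / r) ^ m) * indicator (hball z (r / 2 ^ k)) w" for k w
    have pw: "ennreal (1 / hdist z w ^ m) * indicator (hball z r) w \<le> (\<Sum>k. f k w)" for w
    proof (cases "0 < hdist z w \<and> hdist z w < r")
      case True
      \<comment> \<open>The switch of \<open>P\<close> from false to true locates the shell
        r/2^(k+1) <= d(z,w) < r/2^k.\<close>
      define P where "P k \<longleftrightarrow> r / 2 ^ k \<le> hdist z w" for k
      obtain k0 where "r / hdist z w < 2 ^ k0"
        using real_arch_pow[of 2 "r / hdist z w"] by auto
      with True have "P k0"
        by (simp add: P_def field_simps)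
      moreover have "\<not> P 0"
        using True by (simp add: P_def)
      ultimately obtain k where k: "\<not> P k" "P (Suc k)"
        using ex_least_nat_less[of P k0] by blast
      have "1 / hdist z w \<le> 2 ^ Suc k / r"
        using k(2) True r by (simp add: P_def field_simps)
      then have "(1 / hdist z w) ^ m \<le> (2 ^ Suc k / r) ^ m"
        using True by (intro power_mono) auto
      then have "ennreal (1 / hdist z w ^ m) \<le> f k w"
        using k(1) by (auto simp: f_def P_def hball_def power_one_over intro: ennreal_leI)
      also have "f k w \<le> (\<Sum>k. f k w)"
        using sum_le_suminf[of "\<lambda>k. f k w" "{k}"] by simp
      finally show ?thesis
        using True by (simp add: hball_def)
    next
      case False
      \<comment> \<open>At the pole itself the integrand is 1 / 0 = 0, so the pole needs no
        shell.\<close>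
      then have "hdist z w = 0 \<or> w \<notin> hball z r"
        using hdist_nonneg[of z w] by (auto simp: hball_def simp del: hdist_nonneg hdist_eq_0_iff)
      then have "ennreal (1 / hdist z w ^ m) * indicator (hball z r) w = 0"
        by (auto simp: m_def simp del: hdist_eq_0_iff)
      then show ?thesis
        by (simp only: zero_le)
    qed
    have "(\<integral>\<^sup>+ w. ennreal (1 / hdist z w ^ m) * indicator (hball z r) w \<partial>lborel)
        \<le> (\<integral>\<^sup>+ w. (\<Sum>k. f k w) \<partial>lborel)"
      by (intro nn_integral_mono pw)
    also have "\<dots> = (\<Sum>k. \<integral>\<^sup>+ w. f k w \<partial>lborel)"
      unfolding f_def by (intro nn_integral_suminf) auto
    also have "\<dots> \<le> (\<Sum>k. ennreal (2 ^ m * C1 * r * (1 / 2) ^ k))"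
    proof (intro suminf_le summableI)
      fix k
      have "(\<integral>\<^sup>+ w. f k w \<partial>lborel) = ennreal ((2 ^ Suc k / r) ^ m) * emeasure lborel (hball z (r / 2 ^ k))"
        unfolding f_def by (intro nn_integral_cmult_indicator) auto
      also have "\<dots> \<le> ennreal ((2 ^ Suc k / r) ^ m) * ennreal (C1 * (r / 2 ^ k) ^ Suc m)"
        using r by (intro mult_left_mono C1) auto
      also have "\<dots> = ennreal ((2 ^ Suc k / r) ^ m * (C1 * (r / 2 ^ k) ^ Suc m))"
        using r C1 by (intro ennreal_mult[symmetric]) auto
      also have "(2 ^ Suc k / r) ^ m * (C1 * (r / 2 ^ k) ^ Suc m) = 2 ^ m * C1 * r * (1 / 2) ^ k"
      proof -
        have "(2 ^ Suc k / r) ^ m * (r / 2 ^ k) ^ m = 2 ^ m"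
          using r by (simp flip: power_mult_distrib)
        then have "(2 ^ Suc k / r) ^ m * (r / 2 ^ k) ^ m * (C1 * (r / 2 ^ k)) = 2 ^ m * (C1 * (r / 2 ^ k))"
          by simp
        then show ?thesis
          by (simp add: power_one_over mult_ac)
      qed
      finally show "(\<integral>\<^sup>+ w. f k w \<partial>lborel) \<le> ennreal (2 ^ m * C1 * r * (1 / 2) ^ k)" .
    qed
    also have "\<dots> = ennreal (2 ^ Suc m * C1 * r)"
    proof (rule suminf_ennreal_eq)
      show "0 \<le> 2 ^ m * C1 * r * (1 / 2) ^ k" for k
        using C1 r by simp
      show "(\<lambda>k. 2 ^ m * C1 * r * (1 / 2) ^ k) sums (2 ^ Suc m * C1 * r)"
        using sums_mult[OF geometric_sums[of "1 / 2 :: real"], of "2 ^ m * C1 * r"] by (simp add: mult_ac)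
    qed
    finally show "(\<integral>\<^sup>+ w. ennreal (1 / hdist z w ^ (2 * CARD('n) + 1)) * indicator (hball z r) w \<partial>lborel)
        \<le> ennreal (2 ^ Suc m * C1 * r)"
      unfolding m_def .
  qed
qed

lemma finite_borel_partition:
  assumes "finite F" "E \<in> sets M" "\<And>x. x \<in> F \<Longrightarrow> B x \<in> sets M" "E \<subseteq> (\<Union>x\<in>F. B x)"
  obtains p where "\<And>x. x \<in> F \<Longrightarrow> p x \<in> sets M" "disjoint_family_on p F" "E = (\<Union>x\<in>F. p x)"
    "\<And>x. x \<in> F \<Longrightarrow> p x \<subseteq> B x"
proof -
  have "\<exists>p. (\<forall>x\<in>F. p x \<in> sets M \<and> p x \<subseteq> B x) \<and> disjoint_family_on p F \<and> E = (\<Union>x\<in>F. p x)"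
    using assms
  proof (induction F arbitrary: E rule: finite_induct)
    case (insert x F)
    then have "\<exists>p. (\<forall>x\<in>F. p x \<in> sets M \<and> p x \<subseteq> B x) \<and> disjoint_family_on p F \<and> E - B x = (\<Union>x\<in>F. p x)"
      by (intro insert.IH) auto
    then obtain p where p: "\<forall>x\<in>F. p x \<in> sets M \<and> p x \<subseteq> B x" "disjoint_family_on p F"
        "E - B x = (\<Union>x\<in>F. p x)"
      by blast
    let ?p = "p(x := E \<inter> B x)"
    have "E = (\<Union>y\<in>insert x F. ?p y)"
    proof -
      have "(\<Union>y\<in>insert x F. ?p y) = (E \<inter> B x) \<union> (\<Union>y\<in>F. p y)"
        using insert.hyps by (auto split: if_splits)
      then show ?thesis
        unfolding p(3)[symmetric] by blast
    qed
    moreover have "disjoint_family_on ?p (insert x F)"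
      using p(2,3) insert.hyps unfolding disjoint_family_on_def by (auto split: if_splits)
    moreover have "\<forall>y\<in>insert x F. ?p y \<in> sets M \<and> ?p y \<subseteq> B y"
      using p(1) insert.prems by auto
    ultimately show ?case
      by blast
  qed (simp add: disjoint_family_on_def)
  then show thesis
    using that by blast
qed

section \<open>Solutions along horizontal lines\<close>

lemma hmult_horizontal:
  "hmult z (s *\<^sub>R v, 0) = z + s *\<^sub>R (v, 2 * ((Jmat *v fst z) \<bullet> v))"
  for z :: "'n::finite hpoint"
  by (simp add: hmult_def prod_eq_iff)

lemma sum_Xfield:
  "(\<Sum>i\<in>UNIV. v $ i *\<^sub>R Xfield i z) = (v, 2 * ((Jmat *v fst z) \<bullet> v))"
  for z :: "'n::finite hpoint"
proof -
  have "(\<Sum>i\<in>UNIV. v $ i *\<^sub>R axis i (1::real)) = v"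
    by (simp add: vec_eq_iff axis_def if_distrib[where f = "\<lambda>c. _ * c"] cong: if_cong)
  moreover have "(\<Sum>i\<in>UNIV. v $ i * (2 * (Jmat *v fst z) $ i)) = 2 * ((Jmat *v fst z) \<bullet> v)"
    by (simp add: inner_vec_def sum_distrib_left mult_ac)
  ultimately show ?thesis
    by (simp add: prod_eq_iff fst_sum snd_sum Xfield_def)
qed

text \<open>The line is straight in coordinates, and its velocity is the combination of the fields
  X_i with coefficients \<open>v $ i\<close> at every one of its points. Two differentiations thus
  give the sum of v_i v_j X_j X_i u, whose commutator part cancels by symmetry of v_i v_j.\<close>

lemma has_deriv2_C2_on:
  fixes u :: "'n::finite hpoint \<Rightarrow> real"
  assumes S: "open S" "z \<in> S" and u: "C2_on S u"
  shows "has_deriv2 (\<lambda>s. u (hmult z (s *\<^sub>R v, 0))) (v \<bullet> (hhess u z *v v))"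
proof -
  obtain D1 :: "'n hpoint \<Rightarrow> 'n hpoint \<Rightarrow>\<^sub>L real" and D2
    where D1: "\<And>z. z \<in> S \<Longrightarrow> (u has_derivative blinfun_apply (D1 z)) (at z)"
      and D2: "\<And>z. z \<in> S \<Longrightarrow> (D1 has_derivative blinfun_apply (D2 z)) (at z)"
    using u unfolding C2_on_def by blast
  define G where "G j y = blinfun_apply (D1 y) (Xfield j y)" for j y
  have Xop_u: "Xop j u y = G j y" if "y \<in> S" for j y
    unfolding Xop_def G_def by (simp add: frechet_derivative_at[OF D1[OF that], symmetric])
  have "\<exists>G'. (G j has_derivative G') (at z)" for j
  proof -
    have "(Xfield j has_derivative (\<lambda>h. (0, 2 * (Jmat *v fst h) $ j))) (at z)"
    proof -
      have "((\<lambda>h :: 'n hpoint. (Jmat *v fst h) $ j) has_derivative (\<lambda>h. (Jmat *v fst h) $ j)) (at z)"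
        by (rule bounded_linear_imp_has_derivative,
            rule bounded_linear_compose[OF bounded_linear_vec_nth
              bounded_linear_compose[OF matrix_vector_mul_bounded_linear bounded_linear_fst]])
      then show ?thesis
        unfolding Xfield_def
        by (intro has_derivative_Pair has_derivative_const has_derivative_mult_right)
    qed
    from bounded_bilinear.FDERIV[OF bounded_bilinear_blinfun_apply D2[OF S(2)] this]
    show ?thesis
      unfolding G_def by blast
  qed
  then obtain G' where G': "\<And>j. (G j has_derivative G' j) (at z)"
    by metis
  have XX: "Xop i (Xop j u) z = G' j (Xfield i z)" for i j
  proof -
    have "(Xop j u has_derivative G' j) (at z)"
      by (rule has_derivative_transform_within_open[OF G' S]) (simp add: Xop_u)
    then show ?thesis
      by (simp add: Xop_def[of i] frechet_derivative_at[symmetric])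
  qed
  define \<xi> where "\<xi> = (v, 2 * ((Jmat *v fst z) \<bullet> v))"
  define c where "c s = hmult z (s *\<^sub>R v, 0)" for s
  have c: "c s = z + s *\<^sub>R \<xi>" for s
    by (simp add: c_def \<xi>_def hmult_horizontal)
  have c': "(c has_derivative (\<lambda>t. t *\<^sub>R \<xi>)) (at s)" for s
    unfolding c by (auto intro!: derivative_eq_intros)
  \<comment> \<open>The velocity found at z equals the combination of fields at \<open>c s\<close>,
    since <J(x + s v), v> = <Jx, v>.\<close>
  have \<xi>: "\<xi> = (\<Sum>i\<in>UNIV. v $ i *\<^sub>R Xfield i (c s))" for s
    by (simp add: sum_Xfield \<xi>_def c matrix_vector_right_distrib matrix_vector_mult_scaleR
        inner_add_left)
  have "continuous_on UNIV c"
    unfolding c by (intro continuous_intros)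
  then have "open (c -` S)"
    by (rule open_vimage[OF S(1)])
  then have "\<forall>\<^sub>F s in nhds 0. c s \<in> S"
    using eventually_nhds_in_open[of "c -` S" 0] S(2) by (simp add: c)
  then have "\<forall>\<^sub>F s in nhds 0. ((\<lambda>s. u (c s)) has_real_derivative (\<Sum>i\<in>UNIV. v $ i * G i (c s))) (at s)"
  proof eventually_elim
    case (elim s)
    have "blinfun_apply (D1 (c s)) \<xi> = (\<Sum>i\<in>UNIV. v $ i * G i (c s))"
      by (subst \<xi>[of s]) (simp add: G_def blinfun.sum_right blinfun.scaleR_right)
    moreover have "((\<lambda>s. u (c s)) has_derivative (\<lambda>t. blinfun_apply (D1 (c s)) (t *\<^sub>R \<xi>))) (at s)"
      by (rule has_derivative_compose[OF c' D1[OF elim]])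
    ultimately show ?case
      by (auto intro: has_derivative_imp_has_field_derivative simp: blinfun.scaleR_right)
  qed
  moreover have "((\<lambda>s. \<Sum>i\<in>UNIV. v $ i * G i (c s)) has_real_derivative v \<bullet> (hhess u z *v v)) (at 0)"
  proof -
    have G1: "((\<lambda>s. G i (c s)) has_real_derivative G' i \<xi>) (at 0)" for i
    proof -
      have "(G i has_derivative G' i) (at (c 0))"
        using G' c[of 0] by simp
      from has_derivative_compose[OF c' this]
      have "((\<lambda>s. G i (c s)) has_derivative (\<lambda>t. G' i (t *\<^sub>R \<xi>))) (at 0)" .
      moreover have "G' i (t *\<^sub>R \<xi>) = G' i \<xi> * t" for t
        using has_derivative_bounded_linear[OF G'[of i]]
        by (simp add: linear_simps(5) mult.commute)
      ultimately show ?thesis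
        by (auto intro: has_derivative_imp_has_field_derivative simp: mult.commute)
    qed
    have "G' i \<xi> = (\<Sum>j\<in>UNIV. v $ j * Xop j (Xop i u) z)" for i
    proof -
      interpret bounded_linear "G' i"
        by (rule has_derivative_bounded_linear[OF G'])
      show ?thesis
        using c[of 0] by (subst \<xi>[of 0]) (simp add: sum scaleR XX)
    qed
    then have "(\<Sum>i\<in>UNIV. v $ i * G' i \<xi>) = (\<Sum>i\<in>UNIV. \<Sum>j\<in>UNIV. v $ i * v $ j * Xop j (Xop i u) z)"
      by (simp add: sum_distrib_left mult.assoc)
    moreover have "v \<bullet> (hhess u z *v v)
        = (\<Sum>i\<in>UNIV. \<Sum>j\<in>UNIV. v $ i * v $ j * Xop j (Xop i u) z) / 2
          + (\<Sum>i\<in>UNIV. \<Sum>j\<in>UNIV. v $ i * v $ j * Xop i (Xop j u) z) / 2"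
      by (simp add: inner_vec_def matrix_vector_mult_def hhess_def sum_distrib_left sum_divide_distrib
          algebra_simps add_divide_distrib flip: sum.distrib)
    moreover have "(\<Sum>i\<in>UNIV. \<Sum>j\<in>UNIV. v $ i * v $ j * Xop i (Xop j u) z)
        = (\<Sum>i\<in>UNIV. \<Sum>j\<in>UNIV. v $ i * v $ j * Xop j (Xop i u) z)"
      by (subst sum.swap) (simp add: mult.commute)
    ultimately have "v \<bullet> (hhess u z *v v) = (\<Sum>i\<in>UNIV. v $ i * G' i \<xi>)"
      by simp
    then show ?thesis
      by (simp only:) (intro DERIV_sum DERIV_cmult G1)
  qed
  ultimately show ?thesis
    unfolding has_deriv2_def c_def[symmetric]
    by (intro exI[of _ "\<lambda>s. \<Sum>i\<in>UNIV. v $ i * G i (c s)"] conjI)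
qed

text \<open>The equation is kept only in the form used at an extremum. Quantifying over all
  decompositions lets the same directions serve for u and for the kernels, and the notion passes to
  c - u without reference to Hessians.\<close>

definition is_sol :: "('n::finite hpoint \<Rightarrow> 'n hmat) \<Rightarrow> 'n hpoint set \<Rightarrow> ('n hpoint \<Rightarrow> real) \<Rightarrow> bool" where
  "is_sol A S u \<longleftrightarrow> (\<forall>z\<in>S. \<forall>w. rank_one_decomp (A z) w \<longrightarrow>
     (\<exists>d. (\<forall>k. has_deriv2 (\<lambda>s. u (hmult z (s *\<^sub>R w k, 0))) (d k)) \<and> (\<Sum>k\<in>UNIV. d k) = 0))"

lemma is_sol_subset: "is_sol A S u \<Longrightarrow> T \<subseteq> S \<Longrightarrow> is_sol A T u"
  unfolding is_sol_def by blast

lemma is_sol_const_diff: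
  assumes "is_sol A S u"
  shows "is_sol A S (\<lambda>z. c - u z)"
  unfolding is_sol_def
proof (intro ballI allI impI)
  fix z w assume "z \<in> S" "rank_one_decomp (A z) w"
  with assms obtain d where d: "\<And>k. has_deriv2 (\<lambda>s. u (hmult z (s *\<^sub>R w k, 0))) (d k)"
      "(\<Sum>k\<in>UNIV. d k) = 0"
    unfolding is_sol_def by blast
  have "has_deriv2 (\<lambda>s. c - u (hmult z (s *\<^sub>R w k, 0))) (- d k)" for k
    using has_deriv2_add[OF has_deriv2_const has_deriv2_cmult[OF d(1)], of c "-1" k] by simp
  moreover have "(\<Sum>k\<in>UNIV. - d k) = 0"
    using d(2) by (simp add: sum_negf)
  ultimately show "\<exists>d. (\<forall>k. has_deriv2 (\<lambda>s. c - u (hmult z (s *\<^sub>R w k, 0))) (d k)) \<and> (\<Sum>k\<in>UNIV. d k) = 0"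
    by (intro exI[of _ "\<lambda>k. - d k"]) blast
qed

lemma is_sol_C2_on:
  fixes u :: "'n::finite hpoint \<Rightarrow> real"
  assumes "open \<Omega>" "C2_on \<Omega> u" "S \<subseteq> \<Omega>" "\<And>z. z \<in> S \<Longrightarrow> LA A u z = 0"
  shows "is_sol A S u"
  unfolding is_sol_def
proof (intro ballI allI impI)
  fix z w assume z: "z \<in> S" and w: "rank_one_decomp (A z) w"
  have "hhess u z $ j $ i = hhess u z $ i $ j" for i j
    by (simp add: hhess_def)
  then have "(\<Sum>k\<in>UNIV. w k \<bullet> (hhess u z *v w k)) = LA A u z"
    unfolding rank_one_decomp_trace[OF w, symmetric] LA_def by (intro sum.cong refl) (metis)
  with assms z have "(\<Sum>k\<in>UNIV. w k \<bullet> (hhess u z *v w k)) = 0"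
    by simp
  then show "\<exists>d. (\<forall>k. has_deriv2 (\<lambda>s. u (hmult z (s *\<^sub>R w k, 0))) (d k)) \<and> (\<Sum>k\<in>UNIV. d k) = 0"
    using assms z
    by (intro exI[of _ "\<lambda>k. w k \<bullet> (hhess u z *v w k)"] conjI allI)
       (auto intro!: has_deriv2_C2_on[of \<Omega>])
qed

lemma C2_on_continuous_on:
  assumes "C2_on S u"
  shows "continuous_on S u"
  using assms unfolding C2_on_def
  by (meson continuous_at_imp_continuous_on has_derivative_continuous)

section \<open>Maximum principle and discretised potentials\<close>

lemma has_deriv2_norm_fst_sq:
  "has_deriv2 (\<lambda>s. (norm (fst (hmult y (s *\<^sub>R w, 0))))\<^sup>2) (2 * (norm w)\<^sup>2)"
  for y :: "'n::finite hpoint"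
  unfolding has_deriv2_def
proof (intro exI conjI eventuallyI)
  have eq: "(norm (fst (hmult y (s *\<^sub>R w, 0))))\<^sup>2
      = (norm (fst y))\<^sup>2 + 2 * s * (fst y \<bullet> w) + s\<^sup>2 * (norm w)\<^sup>2" for s
    unfolding power2_norm_eq_inner
    by (simp add: hmult_def inner_add_left inner_add_right inner_commute power2_eq_square
        algebra_simps)
  show "((\<lambda>s. (norm (fst (hmult y (s *\<^sub>R w, 0))))\<^sup>2) has_real_derivative
      2 * (fst y \<bullet> w) + 2 * s * (norm w)\<^sup>2) (at s)" for s
    unfolding eq by (auto intro!: derivative_eq_intros)
  show "((\<lambda>s. 2 * (fst y \<bullet> w) + 2 * s * (norm w)\<^sup>2) has_real_derivative 2 * (norm w)\<^sup>2) (at 0)"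
    by (auto intro!: derivative_eq_intros)
qed

lemma hmult_horizontal_eventually:
  fixes y :: "'n::finite hpoint"
  assumes "open U" "y \<in> U"
  shows "\<forall>\<^sub>F s in nhds 0. hmult y (s *\<^sub>R v, 0) \<in> U"
proof -
  have "continuous_on UNIV (\<lambda>s. hmult y (s *\<^sub>R v, 0))"
    unfolding hmult_horizontal by (intro continuous_intros)
  then have "open ((\<lambda>s. hmult y (s *\<^sub>R v, 0)) -` U)"
    by (rule open_vimage[OF assms(1)])
  then show ?thesis
    using eventually_nhds_in_open[of "(\<lambda>s. hmult y (s *\<^sub>R v, 0)) -` U" 0] assms(2)
    by (simp flip: zero_prod_def)
qed

text \<open>A small multiple of \<open>|x|\<^sup>2\<close>, whose second derivatives along horizontal lines are positive,
  makes the subsolution strict.\<close>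

lemma max_principle:
  fixes v :: "'n::finite hpoint \<Rightarrow> real"
  assumes K: "compact K" and U: "open U" "U \<subseteq> K" and v: "continuous_on K v"
    and bdry: "\<And>y. y \<in> K - U \<Longrightarrow> v y \<le> 0"
    and sub: "\<And>y. y \<in> U \<Longrightarrow> \<exists>w :: 'n + 'n \<Rightarrow> _. \<exists>d.
      (\<forall>k. has_deriv2 (\<lambda>s. v (hmult y (s *\<^sub>R w k, 0))) (d k)) \<and> 0 \<le> (\<Sum>k\<in>UNIV. d k) \<and> (\<exists>k. w k \<noteq> 0)"
    and y0: "y0 \<in> K"
  shows "v y0 \<le> 0"
proof (rule ccontr)
  assume "\<not> v y0 \<le> 0"
  then have pos: "0 < v y0" by simp
  obtain b where b: "0 < b" "\<And>y. y \<in> K \<Longrightarrow> norm y \<le> b"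
    using compact_imp_bounded[OF K] unfolding bounded_pos by blast
  \<comment> \<open>Keeps the added term below half of \<open>v y0\<close> on K, so a maximum point
    of m cannot lie where v <= 0.\<close>
  define \<eta> where "\<eta> = v y0 / (2 * b\<^sup>2)"
  have \<eta>: "0 < \<eta>" using pos b by (simp add: \<eta>_def)
  define m where "m y = v y + \<eta> * (norm (fst y))\<^sup>2" for y
  have "continuous_on K m"
    unfolding m_def by (intro continuous_intros v)
  then obtain y where y: "y \<in> K" "\<And>y'. y' \<in> K \<Longrightarrow> m y' \<le> m y"
    using continuous_attains_sup[OF K, of m] y0 by blast
  have "v y0 \<le> m y0"
    using \<eta> by (simp add: m_def)
  with y(2)[OF y0] have my: "v y0 \<le> m y" by simp
  have "y \<in> U"
  proof (rule ccontr)
    assume "y \<notin> U"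
    with bdry y have "v y \<le> 0" by simp
    moreover have "(norm (fst y))\<^sup>2 \<le> b\<^sup>2"
      using order_trans[OF norm_fst_le[of "fst y" "snd y"], of b] b(2)[OF y(1)]
      by (intro power_mono) simp_all
    then have "\<eta> * (norm (fst y))\<^sup>2 \<le> \<eta> * b\<^sup>2"
      using \<eta> by (intro mult_left_mono) auto
    moreover have "\<eta> * b\<^sup>2 = v y0 / 2"
      using b by (simp add: \<eta>_def)
    ultimately show False
      using my pos by (simp add: m_def)
  qed
  with sub obtain w :: "'n + 'n \<Rightarrow> _" and d where d: "\<And>k. has_deriv2 (\<lambda>s. v (hmult y (s *\<^sub>R w k, 0))) (d k)"
      "0 \<le> (\<Sum>k\<in>UNIV. d k)" and w: "\<exists>k. w k \<noteq> 0"
    by blast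
  have le: "d k + \<eta> * (2 * (norm (w k))\<^sup>2) \<le> 0" for k
  proof (rule has_deriv2_local_max)
    show "has_deriv2 (\<lambda>s. m (hmult y (s *\<^sub>R w k, 0))) (d k + \<eta> * (2 * (norm (w k))\<^sup>2))"
      unfolding m_def by (intro has_deriv2_add has_deriv2_cmult d has_deriv2_norm_fst_sq)
    have "\<forall>\<^sub>F s in nhds 0. hmult y (s *\<^sub>R w k, 0) \<in> U"
      by (rule hmult_horizontal_eventually[OF U(1) \<open>y \<in> U\<close>])
    then show "\<forall>\<^sub>F s in nhds 0. m (hmult y (s *\<^sub>R w k, 0)) \<le> m (hmult y (0 *\<^sub>R w k, 0))"
    proof eventually_elim
      case (elim s)
      then have "m (hmult y (s *\<^sub>R w k, 0)) \<le> m y"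
        using U(2) y(2) by blast
      then show ?case
        by (simp flip: zero_prod_def)
    qed
  qed
  obtain k0 where "w k0 \<noteq> 0" using w by blast
  then have "0 < (\<Sum>k\<in>UNIV. (norm (w k))\<^sup>2)"
    by (intro sum_pos2[of _ k0]) auto
  then have "0 < (\<Sum>k\<in>UNIV. d k) + 2 * \<eta> * (\<Sum>k\<in>UNIV. (norm (w k))\<^sup>2)"
    using d(2) \<eta> by (intro add_nonneg_pos) auto
  also have "\<dots> = (\<Sum>k\<in>UNIV. d k + \<eta> * (2 * (norm (w k))\<^sup>2))"
    by (simp add: sum.distrib sum_distrib_left mult_ac)
  also have "\<dots> \<le> 0"
    by (intro sum_nonpos le)
  finally show False by simp
qed

lemma compact_level_hcball:
  fixes u :: "'n::finite hpoint \<Rightarrow> real"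
  assumes "closed T" "continuous_on (hcball z s) u"
  shows "compact {y \<in> hcball z s. u y \<in> T}"
proof -
  have "closed (hcball z s \<inter> u -` T)"
    by (intro continuous_closed_preimage assms compact_imp_closed compact_hcball)
  moreover have "{y \<in> hcball z s. u y \<in> T} = hcball z s \<inter> (hcball z s \<inter> u -` T)"
    by auto
  ultimately show ?thesis
    by (metis compact_Int_closed compact_hcball)
qed

lemma borel_measurable_hdist [measurable]: "hdist z \<in> borel_measurable borel"
  for z :: "'n::finite hpoint"
  by (intro borel_measurable_continuous_onI continuous_intros)

text \<open>A finite substitute for the potential of Lebesgue measure on E. E is cut into pieces
  that are small compared with its distance to K, and the mass of each piece is put at one point of
  E. Seen from K, distances within a piece then agree up to a factor 2, so the pole integral bounds
  the sum at the cost of 2^m.\<close>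

lemma discrete_potential:
  fixes E K :: "'n::finite hpoint set" and Cp :: real
  defines "m \<equiv> 2 * CARD('n) + 1"
  assumes E: "compact E" and K: "compact K" and disj: "E \<inter> K = {}" and r: "0 < r"
    and EK: "\<And>y. y \<in> K \<Longrightarrow> E \<subseteq> hball y r" and Cp: "0 < Cp"
    and pole: "\<And>y :: 'n hpoint. (\<integral>\<^sup>+ w. ennreal (1 / hdist y w ^ m) * indicator (hball y r) w \<partial>lborel)
        \<le> ennreal (Cp * r)"
  obtains F c where "finite F" "F \<subseteq> E" "\<And>\<zeta>. \<zeta> \<in> F \<Longrightarrow> 0 \<le> c \<zeta>" "sum c F = measure lborel E"
    "\<And>y. y \<in> K \<Longrightarrow> (\<Sum>\<zeta>\<in>F. c \<zeta> / hdist \<zeta> y ^ m) \<le> 2 ^ m * Cp * r"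
proof -
  \<comment> \<open>A positive distance between disjoint compact sets; if one of them is empty any
    value serves, here 1.\<close>
  obtain \<delta> where \<delta>: "0 < \<delta>" "\<And>\<zeta> y. \<zeta> \<in> E \<Longrightarrow> y \<in> K \<Longrightarrow> \<delta> \<le> hdist \<zeta> y"
  proof (cases "E \<times> K = {}")
    case True
    then show thesis using that[of 1] by auto
  next
    case False
    have "continuous_on (E \<times> K) (\<lambda>p. hdist (fst p) (snd p))"
      by (intro continuous_intros)
    then obtain p where p: "p \<in> E \<times> K" "\<And>q. q \<in> E \<times> K \<Longrightarrow> hdist (fst p) (snd p) \<le> hdist (fst q) (snd q)"
      using continuous_attains_inf[OF compact_Times[OF E K] False] by blast
    have "fst p \<noteq> snd p"
      using p(1) disj by auto
    then have "0 < hdist (fst p) (snd p)"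
      using hdist_nonneg[of "fst p" "snd p"] by (simp add: less_le)
    then show thesis
      using p(2) that[of "hdist (fst p) (snd p)"] by fastforce
  qed
  have "E \<subseteq> (\<Union>\<zeta>\<in>E. hball \<zeta> (\<delta> / 2))"
  proof
    fix w assume "w \<in> E"
    then show "w \<in> (\<Union>\<zeta>\<in>E. hball \<zeta> (\<delta> / 2))"
      using \<delta>(1) unfolding hball_def by (intro UN_I[of w]) simp_all
  qed
  then obtain F where F: "F \<subseteq> E" "finite F" "E \<subseteq> (\<Union>\<zeta>\<in>F. hball \<zeta> (\<delta> / 2))"
    using compactE_image[OF E, of E "\<lambda>\<zeta>. hball \<zeta> (\<delta> / 2)"] open_hball by metis
  have E_sets: "E \<in> sets lborel"
    using E by (simp add: compact_imp_closed)
  then obtain p where p: "\<And>\<zeta>. \<zeta> \<in> F \<Longrightarrow> p \<zeta> \<in> sets lborel" "disjoint_family_on p F" "E = (\<Union>\<zeta>\<in>F. p \<zeta>)"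
      "\<And>\<zeta>. \<zeta> \<in> F \<Longrightarrow> p \<zeta> \<subseteq> hball \<zeta> (\<delta> / 2)"
    using finite_borel_partition[OF F(2) E_sets _ F(3)] by (metis borel_hball sets_lborel)
  define c where "c \<zeta> = measure lborel (p \<zeta>)" for \<zeta>
  have E_fin: "emeasure lborel E < \<infinity>"
    by (rule emeasure_compact_finite[OF E])
  have p_fin: "emeasure lborel (p \<zeta>) \<noteq> \<infinity>" if "\<zeta> \<in> F" for \<zeta>
  proof -
    have "emeasure lborel (p \<zeta>) \<le> emeasure lborel E"
      using that E_sets by (intro emeasure_mono) (auto simp: p(3))
    with E_fin show ?thesis by auto
  qed
  have "p ` F \<subseteq> sets lborel"
    using p(1) by blast
  then have "sum c F = measure lborel E"
    unfolding c_def p(3) by (rule measure_finite_Union[OF F(2) _ p(2) p_fin, symmetric])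
  moreover have "(\<Sum>\<zeta>\<in>F. c \<zeta> / hdist \<zeta> y ^ m) \<le> 2 ^ m * Cp * r" if y: "y \<in> K" for y
  proof -
    define g where "g w = ennreal (2 ^ m) * ennreal (1 / hdist y w ^ m)" for w
    have g_meas [measurable]: "g \<in> borel_measurable borel"
      unfolding g_def by measurable
    have "ennreal (c \<zeta> / hdist \<zeta> y ^ m) \<le> (\<integral>\<^sup>+ w. g w * indicator (p \<zeta>) w \<partial>lborel)" if \<zeta>: "\<zeta> \<in> F" for \<zeta>
    proof -
      have le: "ennreal (1 / hdist \<zeta> y ^ m) \<le> g w" if w: "w \<in> p \<zeta>" for w
      proof -
        have "w \<in> E" using w \<zeta> p(3) by blast
        then have d0: "0 < hdist y w"
          using \<delta> y by (metis hdist_commute less_le_trans)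
        have "hdist \<zeta> w < \<delta> / 2"
          using w p(4)[OF \<zeta>] by (auto simp: hball_def)
        also have "\<delta> / 2 \<le> hdist \<zeta> y"
          using \<delta>(2)[of \<zeta> y] \<zeta> F y \<delta>(1) by auto
        finally have "hdist y w \<le> 2 * hdist \<zeta> y"
          using hdist_triangle[of y w \<zeta>] by (simp add: hdist_commute)
        then have "(hdist y w) ^ m \<le> (2 * hdist \<zeta> y) ^ m"
          by (intro power_mono) auto
        moreover have "0 < hdist \<zeta> y"
          using \<delta>(2)[of \<zeta> y] \<zeta> F y \<delta>(1) by auto
        ultimately have "1 / hdist \<zeta> y ^ m \<le> 2 ^ m * (1 / hdist y w ^ m)"
          using d0 by (simp add: field_simps power_mult_distrib)
        then show ?thesis
          unfolding g_def by (simp add: ennreal_leI flip: ennreal_mult)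
      qed
      have "ennreal (c \<zeta> / hdist \<zeta> y ^ m) = ennreal (1 / hdist \<zeta> y ^ m) * emeasure lborel (p \<zeta>)"
        using p_fin[OF \<zeta>] by (simp add: c_def emeasure_eq_ennreal_measure flip: ennreal_mult)
      also have "\<dots> = (\<integral>\<^sup>+ w. ennreal (1 / hdist \<zeta> y ^ m) * indicator (p \<zeta>) w \<partial>lborel)"
        using p(1)[OF \<zeta>] by (rule nn_integral_cmult_indicator[symmetric])
      also have "\<dots> \<le> (\<integral>\<^sup>+ w. g w * indicator (p \<zeta>) w \<partial>lborel)"
        by (intro nn_integral_mono) (auto simp: indicator_def le)
      finally show ?thesis .
    qed
    then have "(\<Sum>\<zeta>\<in>F. ennreal (c \<zeta> / hdist \<zeta> y ^ m)) \<le> (\<Sum>\<zeta>\<in>F. \<integral>\<^sup>+ w. g w * indicator (p \<zeta>) w \<partial>lborel)"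
      by (rule sum_mono)
    also have "\<dots> = (\<integral>\<^sup>+ w. (\<Sum>\<zeta>\<in>F. g w * indicator (p \<zeta>) w) \<partial>lborel)"
      using p(1) by (intro nn_integral_sum[symmetric]) auto
    \<comment> \<open>The pieces are disjoint with union E, so their indicators add up to that of
      E.\<close>
    also have "\<dots> = (\<integral>\<^sup>+ w. g w * indicator E w \<partial>lborel)"
      unfolding p(3) indicator_UN_disjoint[OF F(2) p(2)] sum_distrib_left ..
    also have "\<dots> \<le> (\<integral>\<^sup>+ w. ennreal (2 ^ m) * (ennreal (1 / hdist y w ^ m) * indicator (hball y r) w) \<partial>lborel)"
      using EK[OF y] by (intro nn_integral_mono) (auto simp: indicator_def g_def)
    also have "\<dots> = ennreal (2 ^ m) * (\<integral>\<^sup>+ w. ennreal (1 / hdist y w ^ m) * indicator (hball y r) w \<partial>lborel)"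
      by (intro nn_integral_cmult) measurable
    also have "\<dots> \<le> ennreal (2 ^ m) * ennreal (Cp * r)"
      by (intro mult_left_mono pole) auto
    also have "\<dots> = ennreal (2 ^ m * Cp * r)"
      using Cp r by (simp add: mult.assoc flip: ennreal_mult)
    finally have "ennreal (\<Sum>\<zeta>\<in>F. c \<zeta> / hdist \<zeta> y ^ m) \<le> ennreal (2 ^ m * Cp * r)"
      by (subst (asm) sum_ennreal) (auto simp: c_def)
    then show ?thesis
      using Cp r by (subst (asm) ennreal_le_iff) auto
  qed
  ultimately show thesis
    using F by (intro that[of F c]) (auto simp: c_def)
qed

section \<open>Growth lemma\<close>

text \<open>The second entry serves points where u exceeds t/2, the first one the comparison
  argument. In the first, 4^(2n+1) is 2^m twice, from discretisation and from distances up to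
  2\<rho>; the leading 4 collects the halves of t and of \<beta>; 3 + 8 Lam/lam is M + 2, the scale
  of the ball in which the pole is integrated.\<close>

definition growth_const :: "nat \<Rightarrow> real \<Rightarrow> real \<Rightarrow> real \<Rightarrow> real \<Rightarrow> real" where
  "growth_const n lam Lam C1 Cp =
     min (Lam powr - (n + 1 / 2) /
            (4 * lam powr - (n + 1 / 2) * 4 ^ (2 * n + 1) * Cp * (3 + 8 * Lam / lam)))
         (1 / (2 * C1 * 2 ^ (2 * n + 2)))"

lemma growth_const_pos:
  "0 < lam \<Longrightarrow> 0 < Lam \<Longrightarrow> 0 < C1 \<Longrightarrow> 0 < Cp \<Longrightarrow> 0 < growth_const n lam Lam C1 Cp"
  unfolding growth_const_def by (auto intro!: divide_pos_pos mult_pos_pos add_pos_pos)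

text \<open>The ellipticity bounds are imposed on the inverse P, which defines the kernel.
  \<open>C1\<close> and \<open>Cp\<close> are fixed together with the locale, so that all later
  constants are independent of the centre and of A0.\<close>

locale harnack_frame = frozen_coeffs A0 P for A0 P :: "'n::finite hmat" +
  fixes lam Lam C1 Cp :: real
  assumes lam: "0 < lam" "lam \<le> 1" and Lam: "1 \<le> Lam"
    and P_lower: "lam * (norm x)\<^sup>2 \<le> x \<bullet> (P *v x)"
    and P_upper: "x \<bullet> (P *v x) \<le> Lam * (norm x)\<^sup>2"
    and C1: "0 < C1" and Cp: "0 < Cp"
    and ball_upper: "0 < r \<Longrightarrow> emeasure lborel (hball (z :: 'n hpoint) r) \<le> ennreal (C1 * r ^ (2 * CARD('n) + 2))"
    and pole: "0 < r \<Longrightarrow> (\<integral>\<^sup>+ w. ennreal (1 / hdist (z :: 'n hpoint) w ^ (2 * CARD('n) + 1)) *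
      indicator (hball z r) w \<partial>lborel) \<le> ennreal (Cp * r)"
begin

text \<open>The x-part scales by the bounds on P; the t-part fits the same bounds because lam <= 1
  <= Lam.\<close>

lemma phi_bounds: "lam\<^sup>2 * hgauge h ^ 4 \<le> phi P h" "phi P h \<le> Lam\<^sup>2 * hgauge h ^ 4"
proof -
  have "(lam * (norm (fst h))\<^sup>2)\<^sup>2 \<le> (fst h \<bullet> (P *v fst h))\<^sup>2"
    using lam by (intro power_mono P_lower) auto
  moreover have "lam\<^sup>2 * (snd h)\<^sup>2 \<le> 1 * (snd h)\<^sup>2"
    using lam by (intro mult_right_mono) (auto simp: power_le_one)
  ultimately show "lam\<^sup>2 * hgauge h ^ 4 \<le> phi P h"
    by (simp add: hgauge_power4 phi_def distrib_left power_mult_distrib flip: power_mult)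
  have "(fst h \<bullet> (P *v fst h))\<^sup>2 \<le> (Lam * (norm (fst h))\<^sup>2)\<^sup>2"
    by (intro power_mono P_upper P_psd)
  moreover have "1 * (snd h)\<^sup>2 \<le> Lam\<^sup>2 * (snd h)\<^sup>2"
    using Lam by (intro mult_right_mono) auto
  ultimately show "phi P h \<le> Lam\<^sup>2 * hgauge h ^ 4"
    by (simp add: hgauge_power4 phi_def distrib_left power_mult_distrib flip: power_mult)
qed

lemma phi_pos: "0 < phi P h" if "h \<noteq> 0"
proof -
  have "0 < hgauge h"
    using that hgauge_nonneg[of h] by (simp add: less_le)
  then have "0 < lam\<^sup>2 * hgauge h ^ 4"
    using lam by (intro mult_pos_pos zero_less_power)
  also have "\<dots> \<le> phi P h"
    by (rule phi_bounds)
  finally show ?thesis .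
qed

lemma powr_gauge:
  assumes "0 < L" "0 < \<rho>"
  shows "(L\<^sup>2 * \<rho> ^ 4) powr (- ((2 * real n + 1) / 4)) = L powr - (n + 1 / 2) / \<rho> ^ (2 * n + 1)"
proof -
  have "L\<^sup>2 = L powr 2" "\<rho> ^ 4 = \<rho> powr 4"
    using assms powr_realpow[of L 2] powr_realpow[of \<rho> 4] by auto
  then have "(L\<^sup>2 * \<rho> ^ 4) powr (- ((2 * real n + 1) / 4))
      = L powr (2 * (- ((2 * real n + 1) / 4))) * \<rho> powr (4 * (- ((2 * real n + 1) / 4)))"
    using assms by (simp only: powr_mult powr_powr powr_ge_zero)
  also have "2 * (- ((2 * real n + 1) / 4)) = - (n + 1 / 2)"
    by (simp add: field_simps)
  also have "4 * (- ((2 * real n + 1) / 4)) = - real (2 * n + 1)"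
    by (simp add: field_simps)
  also have "\<rho> powr - real (2 * n + 1) = 1 / \<rho> ^ (2 * n + 1)"
    using assms by (simp only: powr_minus_divide powr_realpow)
  finally show ?thesis
    by simp
qed

lemma kern_bounds:
  assumes "h \<noteq> 0"
  shows "Lam powr - (CARD('n) + 1 / 2) / hgauge h ^ (2 * CARD('n) + 1) \<le> kern P h"
    and "kern P h \<le> lam powr - (CARD('n) + 1 / 2) / hgauge h ^ (2 * CARD('n) + 1)"
proof -
  have pos: "0 < hgauge h"
    using assms hgauge_nonneg[of h] by (simp add: less_le)
  have "(Lam\<^sup>2 * hgauge h ^ 4) powr (- ((2 * real CARD('n) + 1) / 4)) \<le> kern P h"
    unfolding kern_def by (intro powr_mono2' phi_bounds phi_pos assms) simp
  then show "Lam powr - (CARD('n) + 1 / 2) / hgauge h ^ (2 * CARD('n) + 1) \<le> kern P h"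
    using Lam pos by (subst (asm) powr_gauge) auto
  have "kern P h \<le> (lam\<^sup>2 * hgauge h ^ 4) powr (- ((2 * real CARD('n) + 1) / 4))"
    unfolding kern_def by (intro powr_mono2' phi_bounds mult_pos_pos zero_less_power lam pos) simp
  then show "kern P h \<le> lam powr - (CARD('n) + 1 / 2) / hgauge h ^ (2 * CARD('n) + 1)"
    using lam pos by (subst (asm) powr_gauge) auto
qed

definition coeffs_ok :: "('n hpoint \<Rightarrow> 'n hmat) \<Rightarrow> 'n hpoint set \<Rightarrow> bool" where
  "coeffs_ok A S \<longleftrightarrow> (\<forall>y\<in>S. near_A0 (A y) \<and> transpose (A y) = A y \<and>
     (\<forall>\<xi>. lam * (norm \<xi>)\<^sup>2 \<le> \<xi> \<bullet> (A y *v \<xi>)))"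

text \<open>The nonzero direction comes from strict ellipticity; the maximum principle needs it to
  make its perturbation strictly positive.\<close>

lemma coeffs_ok_decomp:
  assumes "coeffs_ok A S" "y \<in> S"
  obtains w k where "rank_one_decomp (A y) w" "w k \<noteq> 0"
proof -
  have lower: "lam * (norm \<xi>)\<^sup>2 \<le> \<xi> \<bullet> (A y *v \<xi>)" for \<xi>
    using assms by (simp add: coeffs_ok_def)
  have "0 \<le> \<xi> \<bullet> (A y *v \<xi>)" for \<xi>
    by (rule order_trans[OF _ lower]) (use lam in simp)
  then obtain w where w: "rank_one_decomp (A y) w"
    using psd_rank_one_decomp[of "A y"] assms by (auto simp: coeffs_ok_def)
  have "\<exists>k. w k \<noteq> 0"
  proof (rule ccontr)
    assume "\<not> (\<exists>k. w k \<noteq> 0)"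
    then have "\<xi> \<bullet> (A y *v \<xi>) = 0" for \<xi>
      by (simp add: rank_one_decomp_quadratic[OF w])
    with lower[of "axis undefined 1"] lam show False
      by (simp add: norm_axis_1)
  qed
  with w that show thesis by blast
qed

text \<open>By associativity, left translation by the inverse of \<zeta> maps horizontal lines to
  horizontal lines, so the estimate at one pole holds at every pole, with the same directions
  \<open>w k\<close>, and can be summed.\<close>

lemma kern_subsolution_sum:
  assumes ok: "coeffs_ok A S" "y \<in> S" and w: "rank_one_decomp (A y) w" and "y \<notin> F"
    and c: "\<And>\<zeta>. \<zeta> \<in> F \<Longrightarrow> 0 \<le> c \<zeta>"
  obtains d where
    "\<And>k. has_deriv2 (\<lambda>s. \<Sum>\<zeta>\<in>F. c \<zeta> * kern P (hmult (hinv \<zeta>) (hmult y (s *\<^sub>R w k, 0)))) (d k)"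
    "0 \<le> (\<Sum>k\<in>UNIV. d k)"
proof -
  have "\<exists>d. (\<forall>k. has_deriv2 (\<lambda>s. kern P (hmult (hinv \<zeta>) (hmult y (s *\<^sub>R w k, 0)))) (d k))
      \<and> 0 \<le> (\<Sum>k\<in>UNIV. d k)" if "\<zeta> \<in> F" for \<zeta>
  proof -
    have "hdist \<zeta> y \<noteq> 0"
      using that \<open>y \<notin> F\<close> by auto
    then have "hmult (hinv \<zeta>) y \<noteq> 0"
      unfolding hdist_def by simp
    moreover have "near_A0 (A y)"
      using ok by (simp add: coeffs_ok_def)
    ultimately show ?thesis
      using kern_subsolution[OF _ w phi_pos, of "hmult (hinv \<zeta>) y"] unfolding hmult_assoc by metis
  qed
  then obtain D where D: "\<And>\<zeta> k. \<zeta> \<in> F \<Longrightarrow>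
        has_deriv2 (\<lambda>s. kern P (hmult (hinv \<zeta>) (hmult y (s *\<^sub>R w k, 0)))) (D \<zeta> k)"
      "\<And>\<zeta>. \<zeta> \<in> F \<Longrightarrow> 0 \<le> (\<Sum>k\<in>UNIV. D \<zeta> k)"
    by metis
  have "0 \<le> (\<Sum>\<zeta>\<in>F. c \<zeta> * (\<Sum>k\<in>UNIV. D \<zeta> k))"
    by (intro sum_nonneg mult_nonneg_nonneg c D)
  also have "\<dots> = (\<Sum>k\<in>UNIV. \<Sum>\<zeta>\<in>F. c \<zeta> * D \<zeta> k)"
    unfolding sum_distrib_left by (rule sum.swap)
  finally show thesis
    by (intro that[of "\<lambda>k. \<Sum>\<zeta>\<in>F. c \<zeta> * D \<zeta> k"] has_deriv2_sum has_deriv2_cmult D)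
qed

text \<open>The factor \<open>8 Lam / lam\<close> is chosen so that at the outer boundary the potential is at most half
  of its lower bound on the inner ball.\<close>

lemma outer_inner_constants:
  assumes "0 < \<rho>"
  shows "lam powr - (n + 1 / 2) / ((8 * Lam / lam) * \<rho>) ^ (2 * n + 1)
    \<le> Lam powr - (n + 1 / 2) / (2 * \<rho>) ^ (2 * n + 1) / 2"
proof -
  define m where "m = 2 * n + 1"
  define b where "b = real n + 1 / 2"
  have "lam powr - b \<le> lam powr - real m"
    using lam by (intro powr_mono') (auto simp: m_def b_def)
  also have "\<dots> = 1 / lam ^ m"
    using lam by (simp add: powr_minus_divide powr_realpow)
  also have "\<dots> \<le> (Lam powr - b * Lam ^ m) * (1 / lam ^ m)"
  proof -
    have "Lam powr - b * Lam ^ m = Lam powr (- b + real m)"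
      using Lam by (simp only: powr_add powr_realpow)
    moreover have "1 \<le> Lam powr (- b + real m)"
      using Lam by (intro ge_one_powr_ge_zero) (auto simp: m_def b_def)
    ultimately show ?thesis
      using lam by (simp add: divide_right_mono)
  qed
  also have "\<dots> = Lam powr - b * (Lam / lam) ^ m"
    by (simp add: power_divide)
  finally have 1: "lam powr - b \<le> Lam powr - b * (Lam / lam) ^ m" .
  have "(1::real) \<le> 4 ^ (2 * n)"
    by simp
  then have "(2::real) \<le> 4 ^ (2 * n) * 4"
    by linarith
  then have "(2::real) \<le> 4 ^ m"
    by (simp only: m_def power_add power_one_right)
  moreover have "(8::real) ^ m = 4 ^ m * 2 ^ m"
    by (simp flip: power_mult_distrib)
  ultimately have "2 * 2 ^ m \<le> (8::real) ^ m"
    by simp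
  then have "lam powr - b * (2 * 2 ^ m) \<le> (Lam powr - b * (Lam / lam) ^ m) * 8 ^ m"
    using lam Lam by (intro mult_mono 1) auto
  also have "\<dots> = Lam powr - b * (8 * Lam / lam) ^ m"
    by (simp add: power_divide power_mult_distrib)
  finally have 2: "lam powr - b * (2 * 2 ^ m) \<le> Lam powr - b * (8 * Lam / lam) ^ m" .
  have frac_le: "a / q \<le> c / p" if "a * p \<le> c * q" "0 < q" "0 < p" for a c p q :: real
    using that by (simp add: field_simps)
  have "lam powr - b / (8 * Lam / lam) ^ m \<le> Lam powr - b / (2 * 2 ^ m)"
    using lam Lam by (intro frac_le 2) auto
  then have "lam powr - b / (8 * Lam / lam) ^ m / \<rho> ^ m \<le> Lam powr - b / (2 * 2 ^ m) / \<rho> ^ m"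
    using assms by (intro divide_right_mono) auto
  then show ?thesis
    unfolding m_def[symmetric] b_def[symmetric] power_mult_distrib[of _ \<rho>]
    by (simp only: divide_divide_eq_left mult_ac)
qed

text \<open>On {u <= t/2} inside the large ball, u is compared with t/(2H) (W - \<beta>/2), where W
  is the discrete potential of {u >= t}. The bound W <= H handles the level set u = t/2, and W <=
  \<beta>/2 handles the outer sphere. On the inner ball W >= \<beta>, which leaves u >=
  t\<beta>/(4H).\<close>

lemma growth:
  fixes u :: "'n hpoint \<Rightarrow> real"
  defines "M \<equiv> 1 + 8 * Lam / lam"
  assumes \<rho>: "0 < \<rho>" and t: "0 < t" and cont: "continuous_on (hcball z (M * \<rho>)) u"
    and sol: "is_sol A (hball z (M * \<rho>)) u" and ok: "coeffs_ok A (hball z (M * \<rho>))"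
    and nonneg: "\<And>y. y \<in> hcball z (M * \<rho>) \<Longrightarrow> 0 \<le> u y" and y0: "y0 \<in> hcball z \<rho>"
  shows "growth_const CARD('n) lam Lam C1 Cp * t * measure lborel {y \<in> hcball z \<rho>. t \<le> u y}
    \<le> u y0 * \<rho> ^ (2 * CARD('n) + 2)"
proof -
  define m where "m = 2 * CARD('n) + 1"
  define kl ku where "kl = Lam powr - (CARD('n) + 1 / 2)" and "ku = lam powr - (CARD('n) + 1 / 2)"
  define E where "E = {y \<in> hcball z \<rho>. t \<le> u y}"
  define g where "g = growth_const CARD('n) lam Lam C1 Cp"
  have kl: "0 < kl" and ku: "0 < ku"
    using lam Lam by (auto simp: kl_def ku_def)
  have M: "1 < M"
    using lam Lam by (simp add: M_def)
  have M\<rho>: "\<rho> < M * \<rho>"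
    using M \<rho> by simp
  have sub: "hcball z \<rho> \<subseteq> hcball z (M * \<rho>)"
    using M\<rho> by (auto simp: hcball_def)
  have E: "compact E"
    using compact_level_hcball[OF closed_atLeast continuous_on_subset[OF cont sub], of t]
    by (simp add: E_def)
  have measE: "measure lborel E \<le> C1 * (2 * \<rho>) ^ (m + 1)"
  proof -
    have "E \<subseteq> hball z (2 * \<rho>)"
      using \<rho> by (auto simp: E_def hcball_def hball_def)
    then have "emeasure lborel E \<le> emeasure lborel (hball z (2 * \<rho>))"
      by (intro emeasure_mono) auto
    also have "\<dots> \<le> ennreal (C1 * (2 * \<rho>) ^ (m + 1))"
      using ball_upper[of "2 * \<rho>" z] \<rho> by (simp add: m_def)
    finally show ?thesis
      unfolding measure_def using C1 \<rho> by (intro enn2real_leI) auto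
  qed
  have Q: "2 * CARD('n) + 2 = m + 1"
    by (simp add: m_def)
  have g1: "g \<le> 1 / (2 * C1 * 2 ^ (m + 1))"
    and g2: "g \<le> kl / (4 * ku * 4 ^ m * Cp * (M + 2))"
    by (simp_all add: g_def growth_const_def m_def kl_def ku_def M_def add_ac)
  show ?thesis
    unfolding g_def[symmetric] E_def[symmetric] Q
  proof (cases "t / 2 < u y0")
    case True
    \<comment> \<open>Here u is already large, and bounding E by the volume of a ball is
      enough.\<close>
    have "g * t * measure lborel E \<le> (1 / (2 * C1 * 2 ^ (m + 1))) * t * (C1 * (2 * \<rho>) ^ (m + 1))"
      using t C1 by (intro mult_mono g1 measE) auto
    also have "\<dots> = t / 2 * \<rho> ^ (m + 1)"
      using C1 by (simp add: power_mult_distrib field_simps)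
    also have "\<dots> \<le> u y0 * \<rho> ^ (m + 1)"
      using True \<rho> by (intro mult_right_mono) auto
    finally show "g * t * measure lborel E \<le> u y0 * \<rho> ^ (m + 1)" .
  next
    case False
    \<comment> \<open>The level t/2, not t, makes K disjoint from E, so all poles stay at positive
      distance from the comparison region.\<close>
    define K where "K = {y \<in> hcball z (M * \<rho>). u y \<le> t / 2}"
    define U where "U = {y \<in> hball z (M * \<rho>). u y < t / 2}"
    have y0K: "y0 \<in> K"
      using False y0 sub by (auto simp: K_def)
    have K: "compact K"
      using compact_level_hcball[OF closed_atMost cont, of "t / 2"] by (simp add: K_def)
    have "continuous_on (hball z (M * \<rho>)) u"
      by (rule continuous_on_subset[OF cont]) (auto simp: hcball_def hball_def)
    then have "open (hball z (M * \<rho>) \<inter> u -` {..<t / 2})"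
      by (intro continuous_open_preimage open_hball) auto
    then have U: "open U"
      by (simp add: U_def vimage_def Int_def)
    have UK: "U \<subseteq> K"
      by (auto simp: U_def K_def hball_def hcball_def)
    have disj: "E \<inter> K = {}"
      using t by (auto simp: E_def K_def)
    \<comment> \<open>Points of K and of E are at most (M + 1)\<rho> apart; one more \<rho> makes
      the inclusion in an open ball strict.\<close>
    define rr where "rr = (M + 2) * \<rho>"
    have rr: "0 < rr"
      using M \<rho> by (simp add: rr_def)
    have EK: "E \<subseteq> hball y rr" if "y \<in> K" for y
    proof
      fix \<zeta> assume "\<zeta> \<in> E"
      then have "hdist z \<zeta> \<le> \<rho>" "hdist y z \<le> M * \<rho>"
        using that by (auto simp: E_def K_def hcball_def hdist_commute)
      then have "hdist y \<zeta> \<le> M * \<rho> + \<rho>"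
        using hdist_triangle[of y \<zeta> z] by simp
      also have "\<dots> < rr"
        using \<rho> by (simp add: rr_def algebra_simps)
      finally show "\<zeta> \<in> hball y rr"
        by (simp add: hball_def)
    qed
    obtain F c where F: "finite F" "F \<subseteq> E" "\<And>\<zeta>. \<zeta> \<in> F \<Longrightarrow> 0 \<le> c \<zeta>" "sum c F = measure lborel E"
      "\<And>y. y \<in> K \<Longrightarrow> (\<Sum>\<zeta>\<in>F. c \<zeta> / hdist \<zeta> y ^ m) \<le> 2 ^ m * Cp * rr"
    proof (rule discrete_potential[OF E K disj rr _ Cp pole[OF rr], folded m_def])
      show "E \<subseteq> hball y rr" if "y \<in> K" for y
        by (rule EK[OF that])
    qed (rule that)
    define W where "W y = (\<Sum>\<zeta>\<in>F. c \<zeta> * kern P (hmult (hinv \<zeta>) y))" for y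
    have nz: "hmult (hinv \<zeta>) y \<noteq> 0" if "\<zeta> \<in> F" "y \<in> K" for \<zeta> y
    proof -
      have "hdist \<zeta> y \<noteq> 0"
        using that F(2) disj by auto
      then show ?thesis
        unfolding hdist_def by simp
    qed
    have kern_le: "kern P (hmult (hinv \<zeta>) y) \<le> ku / hdist \<zeta> y ^ m"
      and kern_ge: "kl / hdist \<zeta> y ^ m \<le> kern P (hmult (hinv \<zeta>) y)"
      and d_pos: "0 < hdist \<zeta> y" if "\<zeta> \<in> F" "y \<in> K" for \<zeta> y
    proof -
      show "kern P (hmult (hinv \<zeta>) y) \<le> ku / hdist \<zeta> y ^ m"
        "kl / hdist \<zeta> y ^ m \<le> kern P (hmult (hinv \<zeta>) y)"
        using kern_bounds[OF nz[OF that]] by (simp_all add: hdist_def m_def kl_def ku_def)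
      show "0 < hdist \<zeta> y"
        using nz[OF that] hgauge_nonneg[of "hmult (hinv \<zeta>) y"] unfolding hdist_def
        by (simp add: less_le)
    qed
    define H where "H = ku * (2 ^ m * Cp * rr)"
    have H: "0 < H"
      using ku Cp rr by (simp add: H_def)
    have W_le: "W y \<le> H" if "y \<in> K" for y
    proof -
      have "W y \<le> (\<Sum>\<zeta>\<in>F. c \<zeta> * (ku / hdist \<zeta> y ^ m))"
        unfolding W_def using that by (intro sum_mono mult_left_mono kern_le F)
      also have "\<dots> = ku * (\<Sum>\<zeta>\<in>F. c \<zeta> / hdist \<zeta> y ^ m)"
        by (simp add: sum_distrib_left mult_ac)
      also have "\<dots> \<le> H"
        unfolding H_def using ku by (intro mult_left_mono F that) auto
      finally show ?thesis .
    qed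
    define \<beta> where "\<beta> = measure lborel E * (kl / (2 * \<rho>) ^ m)"
    have \<beta>0: "0 \<le> \<beta>"
      using kl \<rho> by (simp add: \<beta>_def)
    have W_inner: "\<beta> \<le> W y0"
    proof -
      have "\<beta> = (\<Sum>\<zeta>\<in>F. c \<zeta> * (kl / (2 * \<rho>) ^ m))"
        unfolding \<beta>_def F(4)[symmetric] by (rule sum_distrib_right)
      also have "\<dots> \<le> W y0"
        unfolding W_def
      proof (intro sum_mono mult_left_mono F)
        fix \<zeta> assume \<zeta>: "\<zeta> \<in> F"
        then have "hdist \<zeta> z \<le> \<rho>" "hdist z y0 \<le> \<rho>"
          using F(2) y0 by (auto simp: E_def hcball_def hdist_commute)
        then have "hdist \<zeta> y0 \<le> 2 * \<rho>"
          using hdist_triangle[of \<zeta> y0 z] by simp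
        then have "hdist \<zeta> y0 ^ m \<le> (2 * \<rho>) ^ m"
          by (intro power_mono) auto
        then have "kl / (2 * \<rho>) ^ m \<le> kl / hdist \<zeta> y0 ^ m"
          using kl \<rho> d_pos[OF \<zeta> y0K] by (intro divide_left_mono) auto
        also have "\<dots> \<le> kern P (hmult (hinv \<zeta>) y0)"
          by (rule kern_ge[OF \<zeta> y0K])
        finally show "kl / (2 * \<rho>) ^ m \<le> kern P (hmult (hinv \<zeta>) y0)" .
      qed
      finally show ?thesis .
    qed
    have W_outer: "W y \<le> \<beta> / 2" if y: "y \<in> K" "hdist z y = M * \<rho>" for y
    proof -
      have "W y \<le> (\<Sum>\<zeta>\<in>F. c \<zeta> * (kl / (2 * \<rho>) ^ m / 2))"
        unfolding W_def
      proof (intro sum_mono mult_left_mono F)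
        fix \<zeta> assume \<zeta>: "\<zeta> \<in> F"
        then have "hdist z \<zeta> \<le> \<rho>"
          using F(2) by (auto simp: E_def hcball_def)
        then have "(8 * Lam / lam) * \<rho> \<le> hdist \<zeta> y"
          using hdist_triangle[of z y \<zeta>] y(2) by (simp add: M_def algebra_simps)
        then have "((8 * Lam / lam) * \<rho>) ^ m \<le> hdist \<zeta> y ^ m"
          using lam Lam \<rho> by (intro power_mono) auto
        moreover have "0 < ((8 * Lam / lam) * \<rho>) ^ m" "0 < hdist \<zeta> y ^ m"
          using lam Lam \<rho> d_pos[OF \<zeta> y(1)] by auto
        ultimately have "ku / hdist \<zeta> y ^ m \<le> ku / ((8 * Lam / lam) * \<rho>) ^ m"
          using ku by (intro divide_left_mono mult_pos_pos) auto
        also have "\<dots> \<le> kl / (2 * \<rho>) ^ m / 2"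
          unfolding ku_def kl_def m_def by (rule outer_inner_constants[OF \<rho>])
        finally show "kern P (hmult (hinv \<zeta>) y) \<le> kl / (2 * \<rho>) ^ m / 2"
          using kern_le[OF \<zeta> y(1)] by simp
      qed
      also have "\<dots> = \<beta> / 2"
        unfolding \<beta>_def F(4)[symmetric] by (simp add: sum_distrib_right sum_divide_distrib)
      finally show ?thesis .
    qed
    \<comment> \<open>Subtracting \<beta>/2 makes the barrier nonpositive on the outer sphere and
      still keeps half of its value near the centre.\<close>
    define v where "v y = t / (2 * H) * (W y + - (\<beta> / 2)) + -1 * u y" for y
    have tH: "0 < t / (2 * H)"
      using t H by simp
    have "v y0 \<le> 0"
    proof (rule max_principle[OF K U UK _ _ _ y0K])
      have "continuous_on K (\<lambda>y. kern P (hmult (hinv \<zeta>) y))" if "\<zeta> \<in> F" for \<zeta>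
      proof -
        have "phi P (hmult (hinv \<zeta>) y) \<noteq> 0" if "y \<in> K" for y
          using phi_pos[OF nz[OF \<open>\<zeta> \<in> F\<close> that]] by simp
        moreover have "continuous_on K (\<lambda>y. phi P (hmult (hinv \<zeta>) y))"
          unfolding phi_def
          by (intro continuous_intros matrix_vector_mult_linear_continuous_on[THEN continuous_on_compose2])
             auto
        ultimately show ?thesis
          unfolding kern_def by (intro continuous_on_powr continuous_on_const) auto
      qed
      then show "continuous_on K v"
        unfolding v_def W_def
        by (intro continuous_intros continuous_on_subset[OF cont]) (auto simp: K_def)
      show "v y \<le> 0" if "y \<in> K - U" for y
      proof (cases "hdist z y < M * \<rho>")
        case True
        with that have "u y = t / 2"
          by (auto simp: K_def U_def hball_def)
        moreover have "t / (2 * H) * (W y + - (\<beta> / 2)) \<le> t / (2 * H) * H"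
          using W_le[of y] that \<beta>0 tH by (intro mult_left_mono) auto
        moreover have "t / (2 * H) * H = t / 2"
          using H by simp
        ultimately show ?thesis
          unfolding v_def by linarith
      next
        case False
        with that have "hdist z y = M * \<rho>" "y \<in> K"
          by (auto simp: K_def hcball_def)
        then have "t / (2 * H) * (W y + - (\<beta> / 2)) \<le> 0"
          using W_outer[of y] tH by (intro mult_nonneg_nonpos) auto
        moreover have "0 \<le> u y"
          using \<open>y \<in> K\<close> nonneg by (simp add: K_def)
        ultimately show ?thesis
          by (simp add: v_def)
      qed
      show "\<exists>w :: 'n + 'n \<Rightarrow> _. \<exists>d. (\<forall>k. has_deriv2 (\<lambda>s. v (hmult y (s *\<^sub>R w k, 0))) (d k))
          \<and> 0 \<le> (\<Sum>k\<in>UNIV. d k) \<and> (\<exists>k. w k \<noteq> 0)" if "y \<in> U" for y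
      proof -
        have yb: "y \<in> hball z (M * \<rho>)"
          using that by (simp add: U_def)
        obtain w k0 where w: "rank_one_decomp (A y) w" "w k0 \<noteq> 0"
          using coeffs_ok_decomp[OF ok yb] .
        have "y \<notin> F"
          using that UK F(2) disj by auto
        obtain d where d: "\<And>k. has_deriv2 (\<lambda>s. W (hmult y (s *\<^sub>R w k, 0))) (d k)"
            "0 \<le> (\<Sum>k\<in>UNIV. d k)"
        proof (rule kern_subsolution_sum[OF ok yb w(1) \<open>y \<notin> F\<close>])
          show "0 \<le> c \<zeta>" if "\<zeta> \<in> F" for \<zeta>
            by (rule F(3)[OF that])
        qed (rule that[unfolded W_def])
        obtain d' where d': "\<And>k. has_deriv2 (\<lambda>s. u (hmult y (s *\<^sub>R w k, 0))) (d' k)"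
            "(\<Sum>k\<in>UNIV. d' k) = 0"
          using sol yb w(1) unfolding is_sol_def by blast
        have "has_deriv2 (\<lambda>s. v (hmult y (s *\<^sub>R w k, 0))) (t / (2 * H) * (d k + 0) + -1 * d' k)" for k
          unfolding v_def by (intro has_deriv2_add has_deriv2_cmult has_deriv2_const d d')
        moreover have "(\<Sum>k\<in>UNIV. t / (2 * H) * (d k + 0) + -1 * d' k)
            = t / (2 * H) * (\<Sum>k\<in>UNIV. d k) - (\<Sum>k\<in>UNIV. d' k)"
          by (simp add: sum_subtractf sum_distrib_left)
        moreover have "0 \<le> \<dots>"
          using mult_nonneg_nonneg[OF less_imp_le[OF tH] d(2)] d'(2) by simp
        ultimately show ?thesis
          using w(2) by (intro exI[of _ w] exI[of _ "\<lambda>k. t / (2 * H) * (d k + 0) + -1 * d' k"]) auto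
      qed
    qed
    then have "t / (2 * H) * (W y0 - \<beta> / 2) \<le> u y0"
      by (simp add: v_def)
    moreover have "t / (2 * H) * (\<beta> / 2) \<le> t / (2 * H) * (W y0 - \<beta> / 2)"
      using W_inner tH by (intro mult_left_mono) auto
    ultimately have low: "t / (2 * H) * (\<beta> / 2) \<le> u y0"
      by simp
    have "g * t * measure lborel E \<le> kl / (4 * ku * 4 ^ m * Cp * (M + 2)) * t * measure lborel E"
      using t by (intro mult_right_mono g2) auto
    also have "\<dots> = t / (2 * H) * (\<beta> / 2) * \<rho> ^ (m + 1)"
    proof -
      have "(4::real) ^ m = 2 ^ m * 2 ^ m"
        by (simp flip: power_mult_distrib)
      moreover have "kl / (4 * ku * (p * p) * Cp * X) * t * e
          = t / (2 * (ku * (p * Cp * (X * \<rho>)))) * (e * (kl / (p * R)) / 2) * (\<rho> * R)"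
        if "0 < p" "0 < X" "0 < R" for p X R e
        using that \<rho> kl ku Cp by (simp add: mult_ac)
      ultimately show ?thesis
        unfolding H_def \<beta>_def rr_def power_mult_distrib power_Suc add_Suc_right One_nat_def
        using \<rho> M by simp
    qed
    also have "\<dots> \<le> u y0 * \<rho> ^ (m + 1)"
      using \<rho> by (intro mult_right_mono low) auto
    finally show "g * t * measure lborel E \<le> u y0 * \<rho> ^ (m + 1)" .
  qed
qed

end

section \<open>Harnack inequality\<close>

context harnack_frame
begin

text \<open>The weight \<open>(2r - d(z\<^sub>0, x))\<^sup>Q\<close> replaces the usual iteration: at a maximum point \<open>x\<close> of
  \<open>u\<close> times the weight, \<open>u\<close> is at most \<open>(1 + \<delta>) u(x)\<close> on a ball of radius comparable to
  \<open>2r - d(z\<^sub>0, x)\<close>. Applying the growth lemma to \<open>(1 + \<delta>) u(x) - u\<close> there shows that \<open>u\<close> is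
  at least \<open>u(x) / 2\<close> on a fixed portion of that ball, and applying it to \<open>u\<close> on the large ball
  transfers this to all points near the centre.\<close>

lemma harnack_near_constant:
  fixes u :: "'n hpoint \<Rightarrow> real" and c1 :: real
  defines "M \<equiv> 1 + 8 * Lam / lam" and "q \<equiv> 2 * CARD('n) + 2"
    and "\<delta> \<equiv> growth_const CARD('n) lam Lam C1 Cp * c1 / 8"
  defines "\<kappa> \<equiv> \<delta> / (q * (1 + \<delta>))"
  assumes c1: "0 < c1"
    and ball_lower: "\<And>(z :: 'n hpoint) r. 0 < r \<Longrightarrow> ennreal (c1 * r ^ q) \<le> emeasure lborel (hball z r)"
    and r: "0 < r" and S: "S = hball z0 ((3 * M + 1) * r)"
    and sol: "is_sol A S u" and ok: "coeffs_ok A S" and cont: "continuous_on S u"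
    and nonneg: "\<And>y. y \<in> S \<Longrightarrow> 0 \<le> u y"
    and z: "z \<in> hball z0 r" and w: "w \<in> hball z0 r"
  shows "u z \<le> (3 * M / \<kappa>) ^ q / (2 * \<delta>) * u w"
proof -
  define g where "g = growth_const CARD('n) lam Lam C1 Cp"
  have g: "0 < g"
    unfolding g_def using lam Lam C1 Cp by (intro growth_const_pos) auto
  have M: "1 < M"
    using lam Lam by (simp add: M_def)
  have \<delta>: "0 < \<delta>" "\<delta> = g * c1 / 8"
    using g c1 by (simp_all add: \<delta>_def g_def)
  have q: "1 \<le> real q"
    by (simp add: q_def)
  have "\<delta> < 1 * (1 + \<delta>)"
    by simp
  also have "1 * (1 + \<delta>) \<le> q * (1 + \<delta>)"
    using q \<delta>(1) by (intro mult_right_mono) auto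
  finally have q\<delta>: "\<delta> < q * (1 + \<delta>)" .
  then have \<kappa>: "0 < \<kappa>" "\<kappa> < 1"
    unfolding \<kappa>_def using \<delta>(1) less_trans[OF \<delta>(1) q\<delta>]
    by (simp_all only: zero_less_divide_iff divide_less_eq_1_pos simp_thms)
  \<comment> \<open>\<kappa> is tuned to Bernoulli's inequality: q\<kappa> = \<delta>/(1+\<delta>),
    so shrinking the distance to the sphere of radius 2r by the factor 1 - \<kappa> costs at most 1
    + \<delta> in the weight.\<close>
  have "1 - q * \<kappa> \<le> (1 - \<kappa>) ^ q"
    using Bernoulli_inequality[of "- \<kappa>" q] \<kappa> by simp
  moreover have "q * \<kappa> = \<delta> / (1 + \<delta>)"
    using q by (simp add: \<kappa>_def)
  moreover have "1 - \<delta> / (1 + \<delta>) = 1 / (1 + \<delta>)"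
    using \<delta>(1) by (simp add: field_simps)
  ultimately have "1 / (1 + \<delta>) \<le> (1 - \<kappa>) ^ q"
    by simp
  then have bern: "1 \<le> (1 + \<delta>) * (1 - \<kappa>) ^ q"
    using \<delta>(1) by (simp add: pos_divide_le_eq mult.commute)
  \<comment> \<open>The summand 1 in the radius of S is room for closed balls reaching up to
    distance 3Mr.\<close>
  have subS: "hcball x s \<subseteq> S" if "hdist z0 x + s \<le> 3 * M * r" for x s
  proof
    fix y assume "y \<in> hcball x s"
    then have "hdist z0 y \<le> 3 * M * r"
      using hdist_triangle[of z0 y x] that by (simp add: hcball_def)
    also have "\<dots> < (3 * M + 1) * r"
      using r by (simp add: algebra_simps)
    finally show "y \<in> S"
      by (simp add: S hball_def)
  qed
  have hball_sub: "hball x s \<subseteq> hcball x s" for x :: "'n hpoint" and s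
    by (auto simp: hball_def hcball_def)
  have Mr: "3 * r \<le> 3 * M * r"
    using M r by simp
  define \<Psi> where "\<Psi> x = u x * (2 * r - hdist z0 x) ^ q" for x
  have B2: "hcball z0 (2 * r) \<subseteq> S"
    using subS[of z0 "2 * r"] Mr r by simp
  have zB: "z \<in> hcball z0 (2 * r)"
    using z r by (auto simp: hball_def hcball_def)
  have "continuous_on (hcball z0 (2 * r)) \<Psi>"
    unfolding \<Psi>_def by (intro continuous_intros continuous_on_subset[OF cont B2])
  then obtain x where x: "x \<in> hcball z0 (2 * r)" "\<And>y. y \<in> hcball z0 (2 * r) \<Longrightarrow> \<Psi> y \<le> \<Psi> x"
    using continuous_attains_sup[OF compact_hcball, of z0 "2 * r" \<Psi>] zB by blast
  define D N where "D = 2 * r - hdist z0 x" and "N = u x"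
  have D0: "0 \<le> D"
    using x by (simp add: D_def hcball_def)
  have N0: "0 \<le> N"
    unfolding N_def by (rule nonneg[OF subsetD[OF B2 x(1)]])
  have zS: "z \<in> S" and wS: "w \<in> S" and w3: "w \<in> hcball z0 (3 * r)"
    using zB B2 w r by (auto simp: hball_def hcball_def)
  have "u z * r ^ q \<le> \<Psi> z"
    unfolding \<Psi>_def using z r nonneg[OF zS]
    by (intro mult_left_mono power_mono) (auto simp: hball_def)
  also have "\<dots> \<le> N * D ^ q"
    using x(2)[OF zB] by (simp add: \<Psi>_def N_def D_def)
  finally have uz: "u z * r ^ q \<le> N * D ^ q" .
  show ?thesis
  proof (cases "0 < D \<and> 0 < N")
    case False
    \<comment> \<open>If the maximum of the weighted function is 0, then u z = 0, because the weight
      at z is positive.\<close>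
    then have "N * D ^ q = 0"
      using D0 N0 by (auto simp: q_def)
    with uz have "u z * r ^ q \<le> 0"
      by (simp only:)
    then have "u z \<le> 0"
      using zero_less_power[OF r, of q] by (simp add: mult_le_0_iff)
    also have "0 \<le> (3 * M / \<kappa>) ^ q / (2 * \<delta>) * u w"
      using M \<kappa> \<delta>(1) nonneg[OF wS] by simp
    finally show ?thesis .
  next
    case True
    then have D: "0 < D" and N: "0 < N"
      by auto
    \<comment> \<open>M\<rho> = \<kappa>D: on the whole ball used by the growth lemma the distance
      to the sphere of radius 2r stays at least (1-\<kappa>)D.\<close>
    define \<rho> where "\<rho> = \<kappa> * D / M"
    have \<rho>: "0 < \<rho>" and M\<rho>: "M * \<rho> = \<kappa> * D"
      using D \<kappa> M by (simp_all add: \<rho>_def)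
    have \<kappa>D: "\<kappa> * D \<le> D"
      using D \<kappa> by simp
    have sub2: "hcball x (M * \<rho>) \<subseteq> hcball z0 (2 * r)"
    proof
      fix y assume "y \<in> hcball x (M * \<rho>)"
      then show "y \<in> hcball z0 (2 * r)"
        using hdist_triangle[of z0 y x] \<kappa>D by (simp add: hcball_def M\<rho> D_def)
    qed
    then have subx: "hcball x (M * \<rho>) \<subseteq> S"
      using B2 by blast
    have u_le: "u y \<le> (1 + \<delta>) * N" if y: "y \<in> hcball x (M * \<rho>)" for y
    proof -
      have u0: "0 \<le> u y"
        by (rule nonneg[OF subsetD[OF subx y]])
      have "(1 - \<kappa>) * D \<le> 2 * r - hdist z0 y"
        using hdist_triangle[of z0 y x] y by (simp add: hcball_def M\<rho> D_def algebra_simps)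
      then have "u y * ((1 - \<kappa>) * D) ^ q \<le> \<Psi> y"
        unfolding \<Psi>_def using u0 \<kappa> D by (intro mult_left_mono power_mono) auto
      also have "\<dots> \<le> N * D ^ q"
        using x(2)[OF subsetD[OF sub2 y]] by (simp add: \<Psi>_def N_def D_def)
      finally have "u y * (1 - \<kappa>) ^ q \<le> N"
        using D by (simp add: power_mult_distrib)
      then have "(1 + \<delta>) * (u y * (1 - \<kappa>) ^ q) \<le> (1 + \<delta>) * N"
        using \<delta>(1) by (intro mult_left_mono) auto
      moreover have "u y * 1 \<le> u y * ((1 + \<delta>) * (1 - \<kappa>) ^ q)"
        by (intro mult_left_mono bern u0)
      ultimately show ?thesis
        by (simp add: mult_ac)
    qed
    define v where "v y = (1 + \<delta>) * N - u y" for y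
    define E1 where "E1 = {y \<in> hcball x \<rho>. N / 2 \<le> v y}"
    define E2 where "E2 = {y \<in> hcball z0 (3 * r). N / 2 \<le> u y}"
    have contv: "continuous_on (hcball x (M * \<rho>)) v"
      unfolding v_def by (intro continuous_intros continuous_on_subset[OF cont subx])
    have subx': "hball x (M * \<rho>) \<subseteq> S"
      using subx hball_sub by blast
    have "g * (N / 2) * measure lborel E1 \<le> v x * \<rho> ^ q"
      unfolding g_def E1_def q_def M_def
    proof (rule growth[OF \<rho>])
      show "is_sol A (hball x ((1 + 8 * Lam / lam) * \<rho>)) v"
        unfolding v_def M_def[symmetric] by (rule is_sol_const_diff[OF is_sol_subset[OF sol subx']])
      show "coeffs_ok A (hball x ((1 + 8 * Lam / lam) * \<rho>))"
        using ok subx' unfolding coeffs_ok_def M_def[symmetric] by blast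
    qed (use N contv u_le \<rho> in \<open>auto simp: v_def M_def hcball_def\<close>)
    \<comment> \<open>v x = \<delta>N is tiny, so the growth lemma read backwards says that v is
      rarely large. The 8 in \<delta> limits E1 to a quarter of the lower volume bound, leaving more
      than half of it to E2.\<close>
    also have "v x * \<rho> ^ q = g * (N / 2) * (c1 / 4 * \<rho> ^ q)"
      unfolding v_def N_def[symmetric] \<delta>(2) by (simp add: algebra_simps)
    finally have m1: "measure lborel E1 \<le> c1 / 4 * \<rho> ^ q"
      using g N by simp
    have sub3: "hcball z0 (M * (3 * r)) \<subseteq> S"
      by (rule subS) simp
    have sub3': "hball z0 (M * (3 * r)) \<subseteq> S"
      using sub3 hball_sub by blast
    have m2: "g * (N / 2) * measure lborel E2 \<le> u w * (3 * r) ^ q"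
      unfolding g_def E2_def q_def
    proof (rule growth)
      show "is_sol A (hball z0 ((1 + 8 * Lam / lam) * (3 * r))) u"
        unfolding M_def[symmetric] by (rule is_sol_subset[OF sol sub3'])
      show "coeffs_ok A (hball z0 ((1 + 8 * Lam / lam) * (3 * r)))"
        using ok sub3' unfolding coeffs_ok_def M_def[symmetric] by blast
      show "continuous_on (hcball z0 ((1 + 8 * Lam / lam) * (3 * r))) u"
        unfolding M_def[symmetric] by (rule continuous_on_subset[OF cont sub3])
      show "0 \<le> u y" if "y \<in> hcball z0 ((1 + 8 * Lam / lam) * (3 * r))" for y
        using that sub3 nonneg unfolding M_def[symmetric] by blast
    qed (use N r w3 in auto)
    have "hcball x \<rho> \<subseteq> hcball x (M * \<rho>)"
      using M \<rho> by (auto simp: hcball_def intro: order_trans)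
    then have E1: "compact E1"
      using compact_level_hcball[OF closed_atLeast continuous_on_subset[OF contv], of x \<rho> "N / 2"]
      by (simp add: E1_def)
    have "hcball z0 (3 * r) \<subseteq> S"
      by (rule subS) (use Mr in simp)
    then have E2: "compact E2"
      using compact_level_hcball[OF closed_atLeast continuous_on_subset[OF cont], of z0 "3 * r" "N / 2"]
      by (simp add: E2_def)
    have "hball x \<rho> \<subseteq> E1 \<union> E2"
    proof
      fix y assume y: "y \<in> hball x \<rho>"
      then have "y \<in> hcball x \<rho>" "y \<in> hcball z0 (2 * r)"
        using hball_sub \<open>hcball x \<rho> \<subseteq> hcball x (M * \<rho>)\<close> sub2 by blast+
      moreover have "y \<in> hcball z0 (3 * r)"
        using \<open>y \<in> hcball z0 (2 * r)\<close> r by (simp add: hcball_def)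
      \<comment> \<open>u + v = (1+\<delta>)N, so at each point one of the two is at least
        N/2.\<close>
      moreover have "N / 2 \<le> v y" if "\<not> N / 2 \<le> u y"
        using that mult_pos_pos[OF \<delta>(1) N] N unfolding v_def distrib_right by linarith
      ultimately show "y \<in> E1 \<union> E2"
        by (auto simp: E1_def E2_def)
    qed
    then have "emeasure lborel (hball x \<rho>) \<le> emeasure lborel (E1 \<union> E2)"
      using E1 E2 by (intro emeasure_mono) (auto simp: compact_imp_closed)
    also have "\<dots> \<le> emeasure lborel E1 + emeasure lborel E2"
      using E1 E2 by (intro emeasure_subadditive) (auto simp: compact_imp_closed)
    also have "\<dots> = ennreal (measure lborel E1 + measure lborel E2)"
      using emeasure_compact_finite[OF E1] emeasure_compact_finite[OF E2]
      by (simp add: emeasure_eq_ennreal_measure less_top)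
    finally have "ennreal (c1 * \<rho> ^ q) \<le> ennreal (measure lborel E1 + measure lborel E2)"
      using ball_lower[OF \<rho>, of x] by (rule order_trans[rotated])
    then have "c1 * \<rho> ^ q \<le> measure lborel E1 + measure lborel E2"
      by (subst (asm) ennreal_le_iff) auto
    with m1 have "c1 / 2 * \<rho> ^ q \<le> measure lborel E2"
      using mult_pos_pos[OF c1 zero_less_power[OF \<rho>, of q]] by simp
    then have "g * (N / 2) * (c1 / 2 * \<rho> ^ q) \<le> g * (N / 2) * measure lborel E2"
      using g N by (intro mult_left_mono) auto
    with m2 have "g * (N / 2) * (c1 / 2 * \<rho> ^ q) \<le> u w * (3 * r) ^ q"
      by linarith
    moreover have "g * (N / 2) * (c1 / 2 * \<rho> ^ q) = 2 * \<delta> * (\<kappa> / M) ^ q * (N * D ^ q)"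
      unfolding \<delta>(2) \<rho>_def by (simp add: power_mult_distrib power_divide)
    moreover have "2 * \<delta> * (\<kappa> / M) ^ q * (u z * r ^ q) \<le> 2 * \<delta> * (\<kappa> / M) ^ q * (N * D ^ q)"
      using uz \<delta>(1) \<kappa> M by (intro mult_left_mono) auto
    ultimately have "2 * \<delta> * (\<kappa> / M) ^ q * (u z * r ^ q) \<le> u w * (3 * r) ^ q"
      by linarith
    then have "(2 * \<delta> * (\<kappa> / M) ^ q * u z) * r ^ q \<le> (u w * 3 ^ q) * r ^ q"
      by (simp add: power_mult_distrib mult_ac)
    then have "2 * \<delta> * (\<kappa> / M) ^ q * u z \<le> u w * 3 ^ q"
      using r by simp
    then show ?thesis
      using \<delta>(1) \<kappa> M by (simp add: power_divide power_mult_distrib field_simps)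
  qed
qed

end

section \<open>Freezing the coefficients at the centre\<close>

lemma modulus_small:
  assumes "modulus \<omega>" "0 < e"
  obtains s where "0 < s" "s < 1" "\<omega> s < e"
proof -
  have "(\<omega> \<longlongrightarrow> 0) (at_right 0)"
    using assms(1) by (simp add: modulus_def)
  then have "\<forall>\<^sub>F s in at_right 0. \<omega> s < e"
    using assms(2) by (rule order_tendstoD)
  moreover have "\<forall>\<^sub>F s in at_right 0. s \<in> {0<..<1::real}"
    by (rule eventually_at_right_real) simp
  ultimately have "\<forall>\<^sub>F s in at_right 0. \<omega> s < e \<and> s \<in> {0<..<1}"
    by (rule eventually_conj)
  then obtain s where "\<omega> s < e \<and> s \<in> {0<..<1}"
    using eventually_happens[of _ "at_right (0::real)"] trivial_limit_at_right_real by blast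
  with that show thesis by auto
qed

text \<open>Since the inverse is J^T A0 J and J is an isometry, symmetry, positivity and both
  ellipticity bounds pass from A0 to its inverse with unchanged constants.\<close>

lemma harnack_frame_symplectic:
  fixes A0 :: "'n::finite hmat"
  assumes lam: "0 < lam" "lam \<le> 1" and Lam: "1 \<le> Lam"
    and sym: "transpose A0 = A0" and det: "det A0 = 1"
    and bounds: "\<And>\<xi>. lam * (norm \<xi>)\<^sup>2 \<le> \<xi> \<bullet> (A0 *v \<xi>)" "\<And>\<xi>. \<xi> \<bullet> (A0 *v \<xi>) \<le> Lam * (norm \<xi>)\<^sup>2"
    and sympl: "matrix_inv A0 = transpose Jmat ** A0 ** Jmat"
    and "0 < C1" "0 < Cp"
    "\<And>(z :: 'n hpoint) r. 0 < r \<Longrightarrow> emeasure lborel (hball z r) \<le> ennreal (C1 * r ^ (2 * CARD('n) + 2))"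
    "\<And>(z :: 'n hpoint) r. 0 < r \<Longrightarrow> (\<integral>\<^sup>+ w. ennreal (1 / hdist z w ^ (2 * CARD('n) + 1)) *
      indicator (hball z r) w \<partial>lborel) \<le> ennreal (Cp * r)"
  shows "harnack_frame A0 (matrix_inv A0) lam Lam C1 Cp"
proof -
  have P_J: "x \<bullet> (matrix_inv A0 *v x) = (Jmat *v x) \<bullet> (A0 *v (Jmat *v x))" for x
    unfolding sympl
    by (simp add: dot_lmul_matrix matrix_vector_mul_assoc[symmetric] matrix_transpose_mul
        flip: transpose_matrix_vector)
       (metis dot_lmul_matrix inner_commute transpose_matrix_vector)
  have "invertible A0"
    using det by (simp add: invertible_det_nz)
  then have inv: "A0 ** matrix_inv A0 = mat 1"
    unfolding invertible_def matrix_inv_def by (rule someI2_ex) simp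
  show ?thesis
  proof unfold_locales
    show "transpose (matrix_inv A0) = matrix_inv A0"
      unfolding sympl by (simp add: matrix_transpose_mul sym matrix_mul_assoc)
    show "A0 *v (matrix_inv A0 *v x) = x" for x
      by (simp add: matrix_vector_mul_assoc inv)
    have "0 \<le> lam * (norm x)\<^sup>2" for x :: "real ^ ('n + 'n)"
      using lam by simp
    then show "0 \<le> x \<bullet> (matrix_inv A0 *v x)" for x
      unfolding P_J using bounds(1) order_trans by blast
    show "lam * (norm x)\<^sup>2 \<le> x \<bullet> (matrix_inv A0 *v x)" "x \<bullet> (matrix_inv A0 *v x) \<le> Lam * (norm x)\<^sup>2" for x
      using bounds[of "Jmat *v x"] unfolding P_J norm_Jmat by auto
  qed (use assms P_J in auto)
qed

theorem theorem5p2: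
  fixes lam Lam :: real and \<omega> :: "real \<Rightarrow> real" and m :: real
  assumes "0 < lam" and "lam \<le> 1" and "1 \<le> Lam" and "modulus \<omega>"
  shows "\<exists>C K. 0 < C \<and> 0 < K \<and>
    (\<forall>(\<Omega> :: 'n::finite hpoint set) A u z0 r.
       open \<Omega> \<and> emeasure lborel \<Omega> = ennreal m \<and>
       Mclass lam Lam \<Omega> A \<and> symplectic_on \<Omega> A \<and> Cclass \<Omega> \<omega> A \<and>
       C2_on \<Omega> u \<and> z0 \<in> \<Omega> \<and> 0 < r \<and> hball z0 (K * r) \<subseteq> \<Omega> \<and>
       (\<forall>z\<in>hball z0 (K * r). 0 \<le> u z \<and> LA A u z = 0)
       \<longrightarrow> (\<forall>z\<in>hball z0 r. \<forall>w\<in>hball z0 r. u z \<le> C * u w))"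
proof -
  define q where "q = 2 * CARD('n) + 2"
  obtain c1 C1 :: real where c1: "0 < c1" and C1: "0 < C1"
    and lower: "\<And>(z :: 'n hpoint) r. 0 < r \<Longrightarrow> ennreal (c1 * r ^ q) \<le> emeasure lborel (hball z r)"
    and upper: "\<And>(z :: 'n hpoint) r. 0 < r \<Longrightarrow> emeasure lborel (hball z r) \<le> ennreal (C1 * r ^ q)"
    unfolding q_def using emeasure_hball_bounds[where 'n = 'n] by blast
  obtain Cp :: real where Cp: "0 < Cp"
    and pole: "\<And>(z :: 'n hpoint) r. 0 < r \<Longrightarrow>
      (\<integral>\<^sup>+ w. ennreal (1 / hdist z w ^ (2 * CARD('n) + 1)) * indicator (hball z r) w \<partial>lborel)
        \<le> ennreal (Cp * r)"
    using nn_integral_hdist_pole[where 'n = 'n] by blast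
  define e where "e = 1 / (4 * real CARD('n) + 9)"
  have e: "0 < e"
    by (simp add: e_def add_nonneg_pos)
  \<comment> \<open>The factor lam turns an error in operator norm into one relative to A0: lam e
    |\<xi>|^2 <= e <A0 \<xi>, \<xi>>.\<close>
  obtain s where s: "0 < s" "s < 1" "\<omega> s < lam * e"
    using modulus_small[OF assms(4), of "lam * e"] assms(1) e by auto
  define M where "M = 1 + 8 * Lam / lam"
  define \<delta> where "\<delta> = growth_const CARD('n) lam Lam C1 Cp * c1 / 8"
  define \<kappa> where "\<kappa> = \<delta> / (q * (1 + \<delta>))"
  define T where "T = 3 * M + 1"
  \<comment> \<open>A radius whose ball is too large for \<Omega>: c1 R > m, and R >= 1 gives R <=
    R^q. The absolute value covers every real m.\<close>
  define R where "R = 1 + \<bar>m\<bar> / c1"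
  \<comment> \<open>The first entry places the working ball of radius Tr inside the given one; the
    second turns Kr < R into Tr < s.\<close>
  define K where "K = max T (T * R / s)"
  have M: "1 < M"
    using assms by (simp add: M_def)
  then have T: "1 < T"
    by (simp add: T_def)
  then have K: "T \<le> K" "0 < K"
    by (auto simp: K_def)
  have "0 < \<delta>"
    unfolding \<delta>_def using assms c1 C1 Cp
    by (intro divide_pos_pos mult_pos_pos growth_const_pos) auto
  moreover from this have "0 < \<kappa>"
    unfolding \<kappa>_def q_def by (intro divide_pos_pos mult_pos_pos) auto
  ultimately have C_pos: "0 < (3 * M / \<kappa>) ^ q / (2 * \<delta>)"
    using M by simp
  have harnack: "u z \<le> (3 * M / \<kappa>) ^ q / (2 * \<delta>) * u w"
    if \<Omega>: "open \<Omega>" "emeasure lborel \<Omega> = ennreal m" and M_A: "Mclass lam Lam \<Omega> A"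
      and sympl: "symplectic_on \<Omega> A" and C_A: "Cclass \<Omega> \<omega> A" and u: "C2_on \<Omega> u"
      and z0: "z0 \<in> \<Omega>" and r: "0 < r" and sub: "hball z0 (K * r) \<subseteq> \<Omega>"
      and sol: "\<And>z. z \<in> hball z0 (K * r) \<Longrightarrow> 0 \<le> u z \<and> LA A u z = 0"
      and z: "z \<in> hball z0 r" and w: "w \<in> hball z0 r"
    for \<Omega> :: "'n hpoint set" and A u z0 r z w
  proof -
    have "K * r < R"
    proof (rule ccontr)
      assume "\<not> K * r < R"
      moreover have "1 \<le> R"
        using c1 by (simp add: R_def)
      ultimately have "R \<le> (K * r) ^ q"
        using self_le_power[of "K * r" q] by (simp add: q_def)
      then have "c1 * R \<le> c1 * (K * r) ^ q"
        using c1 by simp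
      moreover have "c1 * R = c1 + \<bar>m\<bar>"
        using c1 by (simp add: R_def field_simps)
      \<comment> \<open>Positivity is recorded as well because \<open>ennreal m\<close> is 0 when m
        is negative.\<close>
      ultimately have less: "m < c1 * (K * r) ^ q" "0 < c1 * (K * r) ^ q"
        using c1 by linarith+
      have "ennreal (c1 * (K * r) ^ q) \<le> emeasure lborel (hball z0 (K * r))"
        using K r by (intro lower) simp
      also have "\<dots> \<le> emeasure lborel \<Omega>"
        using \<Omega>(1) sub by (intro emeasure_mono) auto
      finally have "ennreal (c1 * (K * r) ^ q) \<le> ennreal m"
        by (simp add: \<Omega>(2))
      with less show False
        by (simp add: ennreal_le_iff2)
    qed
    moreover have "T * R / s * r \<le> K * r"
      using r by (intro mult_right_mono) (auto simp: K_def)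
    ultimately have "T * R / s * r < R"
      by simp
    moreover have "0 < R"
      using c1 by (simp add: R_def add_pos_nonneg)
    ultimately have Tr: "T * r < s"
      using s(1) by (simp add: field_simps)
    have near: "hball z0 (T * r) \<subseteq> hball z0 s"
      using Tr by (auto simp: hball_def)
    have "T * r \<le> K * r"
      using K r by simp
    then have small: "hball z0 (T * r) \<subseteq> hball z0 (K * r)"
      by (auto simp: hball_def)
    have A: "transpose (A y) = A y" "det (A y) = 1" "lam * (norm \<xi>)\<^sup>2 \<le> \<xi> \<bullet> (A y *v \<xi>)"
      "\<xi> \<bullet> (A y *v \<xi>) \<le> Lam * (norm \<xi>)\<^sup>2" if "y \<in> \<Omega>" for y \<xi>
      using M_A that by (auto simp: Mclass_def)
    interpret harnack_frame "A z0" "matrix_inv (A z0)" lam Lam C1 Cp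
      using assms(1-3) A[OF z0] sympl z0 C1 Cp upper pole
      by (intro harnack_frame_symplectic) (auto simp: symplectic_on_def q_def)
    have "coeffs_ok A (hball z0 (T * r))"
      unfolding coeffs_ok_def
    proof (intro ballI conjI allI)
      fix y assume "y \<in> hball z0 (T * r)"
      then have y: "y \<in> \<Omega>" "y \<in> hball z0 s \<inter> \<Omega>"
        using near small sub by auto
      show "transpose (A y) = A y" "lam * (norm \<xi>)\<^sup>2 \<le> \<xi> \<bullet> (A y *v \<xi>)" for \<xi>
        by (rule A[OF y(1)])+
      have "onorm (\<lambda>v. (A y - A z0) *v v) \<le> \<omega> s"
        using C_A z0 s y(2) unfolding Cclass_def by blast
      with s have on: "onorm (\<lambda>v. (A y - A z0) *v v) \<le> lam * e"
        by simp
      have "\<bar>\<xi> \<bullet> (A y *v \<xi>) - \<xi> \<bullet> (A z0 *v \<xi>)\<bar> \<le> e * (\<xi> \<bullet> (A z0 *v \<xi>))" for \<xi>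
      proof -
        have "\<bar>\<xi> \<bullet> (A y *v \<xi>) - \<xi> \<bullet> (A z0 *v \<xi>)\<bar> = \<bar>\<xi> \<bullet> ((A y - A z0) *v \<xi>)\<bar>"
          by (simp add: matrix_vector_mult_diff_rdistrib inner_diff_right)
        also have "\<dots> \<le> norm \<xi> * norm ((A y - A z0) *v \<xi>)"
          by (rule Cauchy_Schwarz_ineq2)
        also have "\<dots> \<le> norm \<xi> * (lam * e * norm \<xi>)"
          using onorm[OF matrix_vector_mul_bounded_linear, of "A y - A z0" \<xi>] on
          by (intro mult_left_mono) (auto intro: order_trans[OF _ mult_right_mono])
        also have "\<dots> = e * (lam * (norm \<xi>)\<^sup>2)"
          by (simp add: power2_eq_square)
        also have "\<dots> \<le> e * (\<xi> \<bullet> (A z0 *v \<xi>))"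
          using e by (intro mult_left_mono A z0) auto
        finally show ?thesis .
      qed
      then show "near_A0 (A y)"
        unfolding near_A0_def e_def[symmetric] by (simp add: abs_le_iff algebra_simps)
    qed
    note ok = this
    have sol_T: "is_sol A (hball z0 (T * r)) u"
      by (rule is_sol_C2_on[OF \<Omega>(1) u order_trans[OF small sub]]) (use small sol in blast)
    have cont: "continuous_on (hball z0 (T * r)) u"
      by (rule continuous_on_subset[OF C2_on_continuous_on[OF u] order_trans[OF small sub]])
    show ?thesis
      unfolding M_def \<kappa>_def \<delta>_def q_def
    proof (rule harnack_near_constant[OF c1 _ r _ sol_T ok cont _ z w])
      show "ennreal (c1 * r ^ (2 * CARD('n) + 2)) \<le> emeasure lborel (hball z r)"
        if "0 < r" for z :: "'n hpoint" and r
        using lower[OF that, of z] unfolding q_def .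
      show "hball z0 (T * r) = hball z0 ((3 * (1 + 8 * Lam / lam) + 1) * r)"
        by (simp only: T_def M_def)
      show "0 \<le> u y" if "y \<in> hball z0 (T * r)" for y
        using that small sol by blast
    qed
  qed
  show ?thesis
  proof (rule exI[of _ "(3 * M / \<kappa>) ^ q / (2 * \<delta>)"], rule exI[of _ K], intro conjI allI impI ballI)
    show "0 < (3 * M / \<kappa>) ^ q / (2 * \<delta>)" "0 < K"
      by (rule C_pos K(2))+
    fix \<Omega> :: "'n hpoint set" and A u z0 r z w
    assume "open \<Omega> \<and> emeasure lborel \<Omega> = ennreal m \<and>
       Mclass lam Lam \<Omega> A \<and> symplectic_on \<Omega> A \<and> Cclass \<Omega> \<omega> A \<and>
       C2_on \<Omega> u \<and> z0 \<in> \<Omega> \<and> 0 < r \<and> hball z0 (K * r) \<subseteq> \<Omega> \<and>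
       (\<forall>z\<in>hball z0 (K * r). 0 \<le> u z \<and> LA A u z = 0)"
      and "z \<in> hball z0 r" "w \<in> hball z0 r"
    then show "u z \<le> (3 * M / \<kappa>) ^ q / (2 * \<delta>) * u w"
      by (intro harnack[of \<Omega> A u z0 r z w]) simp_all
  qed
qed

end
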